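(* Let $0 < \alpha < 0.5$ and $0 < p < 1-2\alpha < 1 < c < 2^{1-2\alpha}$. Then for all sufficiently large $N$ there exist $N$-dimensional cooperative bi-quadratic Boolean networks that are $p$-$c$-chaotic and exhibit $p$-$\alpha$-decoherence.
   Context: Write $[N]=\{1,\dots,N\}$. An $N$-dimensional Boolean network is a pair $(2^{[N]},f)$ with $f:\{0,1\}^{[N]}\to\{0,1\}^{[N]}$; it is updated synchronously in discrete time by $\vec{s}(t+1)=f(\vec{s}(t))$, $t=0,1,2,\dots$. The coordinate function $f_j$ is the regulatory function of variable $j$. An attractor is a periodic orbit of $f$ (including fixed points); its length is the number of states in it. The network is cooperative if $\vec{s}\le\vec{s}^{\,*}$ coordinatewise implies $f(\vec{s})\le f(\vec{s}^{\,*})$ coordinatewise. The indegree of variable $j$ is the number of variables from which $f_j$ takes input (i.e. on which $f_j$ depends; $j$ itself is allowed); the outdegree of variable $i$ is the number of variables $j$ such that $f_j$ takes input from $i$. The network is bi-quadratic if every variable has indegree at most $2$ and outdegree at most $2$. The Hamming distance $H(\vec{s},\vec{s}^{\,*})$ is the number of coordinates in which $\vec{s}$ and $\vec{s}^{\,*}$ differ. A randomly chosen initial condition is uniformly distributed on $\{0,1\}^{[N]}$; a random one-bit flip changes the value of one coordinate chosen uniformly from $[N]$, independently of the state. The network is $p$-$c$-chaotic if with probability $>p$ the trajectory of a randomly chosen initial condition reaches an attractor of length $>c^N$. The network exhibits $p$-$\alpha$-decoherence if with probability $\ge p$ a random one-bit flip $\vec{s}^{\,*}(0)$ in a randomly chosen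 initial condition $\vec{s}(0)$ results in trajectories with $H(\vec{s}(t),\vec{s}^{\,*}(t))\ge \alpha N$ for infinitely many times $t>0$. *)

theory Defs
  imports "HOL-Probability.Probability"
begin

text \<open>
  States are extensional functions on \<open>{1..N}\<close>, with \<open>False\<close> for 0 and \<open>True\<close> for 1.
  Only the behaviour of \<open>f\<close> on \<open>states N\<close> is relevant in the notions below.
\<close>

definition states :: "nat \<Rightarrow> (nat \<Rightarrow> bool) set" where
  "states N = {1..N} \<rightarrow>\<^sub>E UNIV"

definition boolean_network :: "nat \<Rightarrow> ((nat \<Rightarrow> bool) \<Rightarrow> (nat \<Rightarrow> bool)) \<Rightarrow> bool" where
  "boolean_network N f \<longleftrightarrow> f \<in> states N \<rightarrow> states N"

definition state_le :: "nat \<Rightarrow> (nat \<Rightarrow> bool) \<Rightarrow> (nat \<Rightarrow> bool) \<Rightarrow> bool" where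
  "state_le N s s' \<longleftrightarrow> (\<forall>i\<in>{1..N}. s i \<le> s' i)"

definition cooperative :: "nat \<Rightarrow> ((nat \<Rightarrow> bool) \<Rightarrow> (nat \<Rightarrow> bool)) \<Rightarrow> bool" where
  "cooperative N f \<longleftrightarrow>
     (\<forall>s\<in>states N. \<forall>s'\<in>states N. state_le N s s' \<longrightarrow> state_le N (f s) (f s'))"

definition flip_bit :: "nat \<Rightarrow> (nat \<Rightarrow> bool) \<Rightarrow> (nat \<Rightarrow> bool)" where
  "flip_bit i s = s(i := \<not> s i)"

definition takes_input_from ::
    "nat \<Rightarrow> ((nat \<Rightarrow> bool) \<Rightarrow> (nat \<Rightarrow> bool)) \<Rightarrow> nat \<Rightarrow> nat \<Rightarrow> bool" where
  "takes_input_from N f j i \<longleftrightarrow> (\<exists>s\<in>states N. f (flip_bit i s) j \<noteq> f s j)"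

definition indegree :: "nat \<Rightarrow> ((nat \<Rightarrow> bool) \<Rightarrow> (nat \<Rightarrow> bool)) \<Rightarrow> nat \<Rightarrow> nat" where
  "indegree N f j = card {i\<in>{1..N}. takes_input_from N f j i}"

definition outdegree :: "nat \<Rightarrow> ((nat \<Rightarrow> bool) \<Rightarrow> (nat \<Rightarrow> bool)) \<Rightarrow> nat \<Rightarrow> nat" where
  "outdegree N f i = card {j\<in>{1..N}. takes_input_from N f j i}"

definition bi_quadratic :: "nat \<Rightarrow> ((nat \<Rightarrow> bool) \<Rightarrow> (nat \<Rightarrow> bool)) \<Rightarrow> bool" where
  "bi_quadratic N f \<longleftrightarrow> (\<forall>i\<in>{1..N}. indegree N f i \<le> 2 \<and> outdegree N f i \<le> 2)"

definition hamming :: "nat \<Rightarrow> (nat \<Rightarrow> bool) \<Rightarrow> (nat \<Rightarrow> bool) \<Rightarrow> nat" where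
  "hamming N s s' = card {i\<in>{1..N}. s i \<noteq> s' i}"

definition trajectory ::
    "((nat \<Rightarrow> bool) \<Rightarrow> (nat \<Rightarrow> bool)) \<Rightarrow> (nat \<Rightarrow> bool) \<Rightarrow> nat \<Rightarrow> (nat \<Rightarrow> bool)" where
  "trajectory f s t = (f ^^ t) s"

definition attractor ::
    "nat \<Rightarrow> ((nat \<Rightarrow> bool) \<Rightarrow> (nat \<Rightarrow> bool)) \<Rightarrow> (nat \<Rightarrow> bool) set \<Rightarrow> bool" where
  "attractor N f A \<longleftrightarrow>
     (\<exists>s\<in>states N. (\<exists>k>0. trajectory f s k = s) \<and> A = range (trajectory f s))"

definition random_state :: "nat \<Rightarrow> (nat \<Rightarrow> bool) pmf" where
  "random_state N = pmf_of_set (states N)"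

definition chaotic ::
    "real \<Rightarrow> real \<Rightarrow> nat \<Rightarrow> ((nat \<Rightarrow> bool) \<Rightarrow> (nat \<Rightarrow> bool)) \<Rightarrow> bool" where
  "chaotic p c N f \<longleftrightarrow>
     measure_pmf.prob (random_state N)
       {s. \<exists>A. attractor N f A \<and> (\<exists>t. trajectory f s t \<in> A) \<and> real (card A) > c ^ N} > p"

text \<open>
  The product distribution below makes the position of the flipped bit uniform on
  \<open>{1..N}\<close> and independent of the initial state; it is meaningful for \<open>N > 0\<close> only.
\<close>

definition decoherent ::
    "real \<Rightarrow> real \<Rightarrow> nat \<Rightarrow> ((nat \<Rightarrow> bool) \<Rightarrow> (nat \<Rightarrow> bool)) \<Rightarrow> bool" where
  "decoherent p \<alpha> N f \<longleftrightarrow>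
     measure_pmf.prob (pair_pmf (random_state N) (pmf_of_set {1..N}))
       {(s, i). infinite {t. t > 0 \<and>
          real (hamming N (trajectory f s t) (trajectory f (flip_bit i s) t)) \<ge> \<alpha> * real N}} \<ge> p"

end

theory Submission
  imports Defs "HOL-Real_Asymp.Real_Asymp"
begin

text \<open>
  \<^bold>\<open>Counting.\<close> A monotone circuit is free to compute any function on an antichain of input
  words. The middle layer of \<open>{0,1}\<^sup>l\<close> is an antichain with nearly \<open>2\<^sup>l\<close> elements, so its words
  can serve as digits of nearly \<open>l\<close> bits each, and one circuit of constant size can add a carry to
  a digit. The digits circulate in \<open>l\<close> parallel shift registers, which consist of COPY gates, and
  pass this circuit once per round of \<open>M\<close> steps. They form a single number in base \<open>q\<close> that is
  incremented in every round; it has a period of at least \<open>q^(M - 2)\<close>, which is about \<open>2^(l * M)\<close>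
  (locale \<open>pipelined_counter\<close>). Nearly all nodes of this part are register cells, so the exponent
  is nearly the number of its nodes.

  \<^bold>\<open>Starting.\<close> In a random state most words are not digits. Hence in the first round everything
  that leaves the registers is discarded and replaced by digits 0, and then a single marker is
  inserted that tells where the number begins. The circuit is switched from one phase to the next
  by timers. A timer is a ladder \<open>u\<^sub>k' = u\<^sub>k\<^sub>-\<^sub>1 \<and> u\<^sub>k\<^sub>-\<^sub>2\<close> fed with the constant 1: its end is certain
  to be 1 once the constant has arrived, and before that it is a conjunction of many random bits.
  With \<open>h\<close> ladders in parallel, all of them are right at all times except with a probability of
  order \<open>2\<^sup>-\<^sup>h\<close> (\<open>prob_timers\<close>). Disjunctions and the constant 0 give the complementary signals,
  which are needed because negation is not available.

  \<^bold>\<open>Remembering.\<close> The initial words must leave a trace, since otherwise flipped bits would have no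
  lasting effect. While a word is discarded, the circuit records for \<open>r\<close> thresholds around \<open>l / 2\<close>
  whether its number of ones exceeds them. That number differs from \<open>l / 2\<close> by an order of \<open>\<surd>l\<close>, so
  \<open>r = o(l)\<close> thresholds suffice with high probability, and then every flip of one bit changes
  exactly one of the recorded bits. The records are kept for ever in a negligible number of
  additional registers, and each of them passes the end of the register \<open>Rec 0\<close> infinitely often
  (\<open>recorded\<close>).

  \<^bold>\<open>Amplifying.\<close> A binary tree of COPY gates takes the output of that register to \<open>\<alpha> * N\<close> leaves at
  the same depth, so that a difference in one record becomes a Hamming distance of \<open>\<alpha> * N\<close>
  (\<open>spreading\<close>). The tree occupies \<open>2 * \<alpha> * N\<close> nodes. The other \<open>(1 - 2 * \<alpha>) * N\<close> nodes are almost
  all register cells holding digits, and their share determines both the exponent of the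
  period and the probability that a random flip hits one of them.

  The parameters \<open>l\<close>, \<open>r\<close>, \<open>h\<close> and the circuit depend on \<open>\<alpha>\<close>, \<open>p\<close>, \<open>c\<close> only; for \<open>N\<close> tending to
  infinity just the registers, the timers and the tree grow.
\<close>

section \<open>Networks of gates and monotone formulas\<close>

datatype 'v gate = Const bool | And 'v 'v | Or 'v 'v

abbreviation Copy :: "'v \<Rightarrow> 'v gate" where "Copy v \<equiv> And v v"

fun gate_val :: "'v gate \<Rightarrow> ('v \<Rightarrow> bool) \<Rightarrow> bool" where
  "gate_val (Const b) s = b"
| "gate_val (And u v) s = (s u \<and> s v)"
| "gate_val (Or u v) s = (s u \<or> s v)"

fun gate_inputs :: "'v gate \<Rightarrow> 'v set" where
  "gate_inputs (Const b) = {}"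
| "gate_inputs (And u v) = {u, v}"
| "gate_inputs (Or u v) = {u, v}"

lemma card_gate_inputs: "card (gate_inputs g) \<le> 2"
  by (cases g) (auto simp: card_insert_if)

lemma finite_gate_inputs: "finite (gate_inputs g)"
  by (cases g) auto

lemma gate_val_cong: "(\<And>u. u \<in> gate_inputs g \<Longrightarrow> s u = s' u) \<Longrightarrow> gate_val g s = gate_val g s'"
  by (cases g) auto

lemma gate_val_mono: "(\<And>u. u \<in> gate_inputs g \<Longrightarrow> s u \<le> s' u) \<Longrightarrow> gate_val g s \<le> gate_val g s'"
  by (cases g) auto

text \<open>
  A network may thus be designed on nodes of any type; numbering them turns the number of nodes that
  read a node into its outdegree. That \<open>f\<close> obeys the gates on all functions, and not on states only,
  covers the states that result from flipping a bit.
\<close>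
lemma gates_to_network:
  fixes gate :: "'v \<Rightarrow> 'v gate"
  assumes V: "finite V" "card V = N"
    and inputs: "\<And>v. v \<in> V \<Longrightarrow> gate_inputs (gate v) \<subseteq> V"
    and fanout: "\<And>u. u \<in> V \<Longrightarrow> card {v\<in>V. u \<in> gate_inputs (gate v)} \<le> 2"
  obtains f e where "bij_betw e V {1..N}"
    and "boolean_network N f" "cooperative N f" "bi_quadratic N f"
    and "\<And>s v. v \<in> V \<Longrightarrow> f s (e v) = gate_val (gate v) (\<lambda>u. s (e u))"
proof -
  obtain e where e: "bij_betw e V {1..N}"
    using V by (metis card_atLeastAtMost diff_Suc_1 finite_atLeastAtMost finite_same_card_bij)
  define e' where "e' = the_inv_into V e"
  have e'e: "e' (e v) = v" if "v \<in> V" for v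
    using that e by (simp add: e'_def bij_betw_def the_inv_into_f_f)
  have ee': "e (e' i) = i" "e' i \<in> V" if "i \<in> {1..N}" for i
    using that e by (auto simp: e'_def bij_betw_def f_the_inv_into_f intro: the_inv_into_into)
  have eV: "e v \<in> {1..N}" if "v \<in> V" for v
    using that e by (auto simp: bij_betw_def)
  define f where "f s = (\<lambda>i\<in>{1..N}. gate_val (gate (e' i)) (\<lambda>u. s (e u)))" for s
  have val: "f s (e v) = gate_val (gate v) (\<lambda>u. s (e u))" if "v \<in> V" for s v
    using that eV[of v] by (simp add: f_def e'e)
  have dep: "e' i \<in> gate_inputs (gate (e' j))"
    if takes: "takes_input_from N f j i" and i: "i \<in> {1..N}" and j: "j \<in> {1..N}" for i j
  proof (rule ccontr)
    assume neg: "e' i \<notin> gate_inputs (gate (e' j))"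
    obtain s where "f (flip_bit i s) j \<noteq> f s j"
      using takes unfolding takes_input_from_def by blast
    moreover have "f (flip_bit i s) j = f s j"
      unfolding f_def restrict_apply'[OF j]
    proof (rule gate_val_cong)
      fix u assume u: "u \<in> gate_inputs (gate (e' j))"
      then have "u \<in> V" using inputs ee'(2)[OF j] by blast
      then have "e u \<noteq> i" using u neg e'e by metis
      then show "flip_bit i s (e u) = s (e u)" by (simp add: flip_bit_def)
    qed
    ultimately show False by simp
  qed
  have "boolean_network N f"
    by (auto simp: boolean_network_def states_def f_def)
  moreover have "cooperative N f"
    unfolding cooperative_def state_le_def
  proof (intro ballI impI)
    fix s s' :: "nat \<Rightarrow> bool" and i assume le: "\<forall>i\<in>{1..N}. s i \<le> s' i" and i: "i \<in> {1..N}"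
    show "f s i \<le> f s' i"
      unfolding f_def restrict_apply'[OF i]
    proof (rule gate_val_mono)
      fix u assume "u \<in> gate_inputs (gate (e' i))"
      then show "s (e u) \<le> s' (e u)" using inputs ee'(2)[OF i] eV le by blast
    qed
  qed
  moreover have "bi_quadratic N f"
    unfolding bi_quadratic_def
  proof (intro ballI conjI)
    fix i assume i: "i \<in> {1..N}"
    have "{j \<in> {1..N}. takes_input_from N f i j} \<subseteq> e ` gate_inputs (gate (e' i))"
    proof safe
      fix j assume "takes_input_from N f i j" "j \<in> {1..N}"
      then have "e' j \<in> gate_inputs (gate (e' i))" "e (e' j) = j" using dep i ee'(1) by blast+
      then show "j \<in> e ` gate_inputs (gate (e' i))" by (metis image_eqI)
    qed
    then have "indegree N f i \<le> card (gate_inputs (gate (e' i)))"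
      unfolding indegree_def by (rule surj_card_le[OF finite_gate_inputs])
    then show "indegree N f i \<le> 2" using card_gate_inputs order_trans by blast
    have "{j \<in> {1..N}. takes_input_from N f j i} \<subseteq> e ` {v\<in>V. e' i \<in> gate_inputs (gate v)}"
    proof safe
      fix j assume "takes_input_from N f j i" "j \<in> {1..N}"
      then have "e' j \<in> {v\<in>V. e' i \<in> gate_inputs (gate v)}" "e (e' j) = j"
        using dep[of j i] i ee'[of j] by auto
      then show "j \<in> e ` {v\<in>V. e' i \<in> gate_inputs (gate v)}" by (metis image_eqI)
    qed
    then have "outdegree N f i \<le> card {v\<in>V. e' i \<in> gate_inputs (gate v)}"
      unfolding outdegree_def using V by (intro surj_card_le) auto
    then show "outdegree N f i \<le> 2" using fanout[OF ee'(2)[OF i]] by linarith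
  qed
  ultimately show ?thesis using that e val by blast
qed

datatype 'r formula = Var 'r | Cst bool | Conj "'r formula" "'r formula" | Disj "'r formula" "'r formula"

fun formula_val :: "'r formula \<Rightarrow> ('r \<Rightarrow> bool) \<Rightarrow> bool" where
  "formula_val (Var r) x = x r"
| "formula_val (Cst b) x = b"
| "formula_val (Conj \<phi> \<psi>) x = (formula_val \<phi> x \<and> formula_val \<psi> x)"
| "formula_val (Disj \<phi> \<psi>) x = (formula_val \<phi> x \<or> formula_val \<psi> x)"

fun formula_vars :: "'r formula \<Rightarrow> 'r set" where
  "formula_vars (Var r) = {r}"
| "formula_vars (Cst b) = {}"
| "formula_vars (Conj \<phi> \<psi>) = formula_vars \<phi> \<union> formula_vars \<psi>"
| "formula_vars (Disj \<phi> \<psi>) = formula_vars \<phi> \<union> formula_vars \<psi>"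

fun formula_depth :: "'r formula \<Rightarrow> nat" where
  "formula_depth (Var r) = 0"
| "formula_depth (Cst b) = 0"
| "formula_depth (Conj \<phi> \<psi>) = Suc (max (formula_depth \<phi>) (formula_depth \<psi>))"
| "formula_depth (Disj \<phi> \<psi>) = Suc (max (formula_depth \<phi>) (formula_depth \<psi>))"

text \<open>
  The induction removes one variable by Shannon expansion. For a monotone function the negated
  variable can be dropped: \<open>G x = G (x(r := False)) \<or> (x r \<and> G (x(r := True)))\<close>.
\<close>
lemma monotone_formula:
  fixes G :: "('r \<Rightarrow> bool) \<Rightarrow> bool"
  assumes "finite R" "mono G" "\<And>x y. (\<And>r. r \<in> R \<Longrightarrow> x r = y r) \<Longrightarrow> G x = G y"
  shows "\<exists>\<phi>. formula_vars \<phi> \<subseteq> R \<and> (\<forall>x. formula_val \<phi> x = G x)"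
  using assms
proof (induction R arbitrary: G rule: finite_induct)
  case empty
  have "formula_val (Cst (G (\<lambda>_. False))) x = G x" for x
    unfolding formula_val.simps by (rule empty.prems(2)) simp
  then show ?case by (intro exI[of _ "Cst (G (\<lambda>_. False))"]) auto
next
  case (insert r R)
  have sub: "\<exists>\<phi>. formula_vars \<phi> \<subseteq> R \<and> (\<forall>x. formula_val \<phi> x = G (x(r := b)))" for b
  proof (rule insert.IH)
    show "mono (\<lambda>x. G (x(r := b)))"
      by (intro monoI monoD[OF insert.prems(1)]) (auto simp: le_fun_def)
    show "G (x(r := b)) = G (y(r := b))" if "\<And>r. r \<in> R \<Longrightarrow> x r = y r" for x y
      by (rule insert.prems(2)) (use that in auto)
  qed
  obtain \<phi> \<psi> where \<phi>: "formula_vars \<phi> \<subseteq> R" "\<And>x. formula_val \<phi> x = G (x(r := False))"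
    and \<psi>: "formula_vars \<psi> \<subseteq> R" "\<And>x. formula_val \<psi> x = G (x(r := True))"
    using sub by metis
  have "formula_val (Disj \<phi> (Conj (Var r) \<psi>)) x = G x" for x
  proof (cases "x r")
    case True
    then have "x(r := True) = x" by (intro fun_upd_idem) simp
    moreover have "G (x(r := False)) \<le> G x"
      by (rule monoD[OF insert.prems(1)]) (auto simp: le_fun_def)
    ultimately show ?thesis using True \<phi> \<psi> by auto
  next
    case False
    then have "x(r := False) = x" by (intro fun_upd_idem) simp
    then show ?thesis using False \<phi> by auto
  qed
  then show ?case using \<phi>(1) \<psi>(1)
    by (intro exI[of _ "Disj \<phi> (Conj (Var r) \<psi>)"]) auto
qed

section \<open>A pipelined counter\<close>

text \<open>
  The value \<open>q\<close> is not a digit but the marker in front of the least significant digit. It is never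
  changed, and it emits a carry whenever it is read, which starts the next increment.
\<close>
definition next_digit :: "nat \<Rightarrow> nat \<Rightarrow> bool \<Rightarrow> nat" where
  "next_digit q d c = (if d = q then q else (d + of_bool c) mod q)"

definition carry_out :: "nat \<Rightarrow> nat \<Rightarrow> bool \<Rightarrow> bool" where
  "carry_out q d c \<longleftrightarrow> d = q \<or> (c \<and> Suc d = q)"

lemma digit_Suc:
  fixes v Q q :: nat
  assumes "Q > 0" "q > 0"
  shows "Suc v div Q mod q = (v div Q mod q + of_bool (Suc v mod Q = 0)) mod q"
  by (auto simp: div_Suc mod_Suc_eq)

lemma carry_Suc:
  fixes v Q q :: nat
  assumes "Q > 0" "q > 0"
  shows "Suc v mod (Q * q) = 0 \<longleftrightarrow> Suc v mod Q = 0 \<and> Suc (v div Q mod q) = q"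
proof -
  have "Suc v mod (Q * q) = 0 \<longleftrightarrow> Suc v mod Q = 0 \<and> (Suc v div Q) mod q = 0"
    unfolding mod_mult2_eq add_is_0 mult_is_0 using assms(1) by (metis neq0_conv)
  moreover have "Suc v div Q = Suc (v div Q)" if "Suc v mod Q = 0"
    using that by (simp add: div_Suc)
  moreover have "Suc a mod q = 0 \<longleftrightarrow> Suc (a mod q) = q" for a
    using assms(2) by (auto simp only: mod_Suc split: if_splits)
  ultimately show ?thesis by metis
qed

text \<open>
  \<open>W t\<close> and \<open>c t\<close> are the word and the carry that the adder reads at time \<open>t\<close>. The word read at time
  \<open>t\<close> returns \<open>M\<close> steps later. The adder needs \<open>D\<close> steps, so that its carry meets the word that is
  \<open>D\<close> places behind. As \<open>M\<close> is 1 modulo \<open>D\<close>, steps of length \<open>D\<close> lead from the marker to all other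
  places of the ring, and the \<open>M - 1\<close> other words form one number: its \<open>j\<close>-th digit is \<open>j * D\<close> places
  behind the marker. A carry needs about \<open>D\<close> rounds to pass through the number, and meanwhile the
  marker has launched further ones; this does not matter since they reach each digit in order.
\<close>
locale pipelined_counter =
  fixes q D m M :: nat and W :: "nat \<Rightarrow> nat" and c :: "nat \<Rightarrow> bool"
  assumes q: "2 \<le> q" and D: "0 < D" and m: "0 < m" and M: "M = m * D + 1"
    and W_zero: "\<And>t. 0 < t \<Longrightarrow> t < M \<Longrightarrow> W t = 0"
    and W_mark: "W M = q"
    and c_zero: "\<And>t. 0 < t \<Longrightarrow> t \<le> D \<Longrightarrow> \<not> c t"
    and W_step: "\<And>t. 0 < t \<Longrightarrow> W (t + M) = next_digit q (W t) (c t)"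
    and c_step: "\<And>t. 0 < t \<Longrightarrow> c (t + D) = carry_out q (W t) (c t)"
begin

lemma mark: "0 < k \<Longrightarrow> W (k * M) = q"
proof (induction k)
  case (Suc k)
  show ?case
  proof (cases "k = 0")
    case False
    then have "W (k * M + M) = q" using Suc M by (subst W_step) (auto simp: next_digit_def)
    then show ?thesis by (simp add: add.commute)
  qed (use W_mark in simp)
qed simp

lemma dvd_mult_D: "int M dvd int j * int D \<Longrightarrow> j < M \<Longrightarrow> j = 0"
proof -
  assume dvd: "int M dvd int j * int D" and j: "j < M"
  have "coprime M D"
    unfolding M by (intro coprimeI) (metis dvd_add_right_iff dvd_mult)
  moreover have "M dvd j * D" using dvd by (metis int_dvd_int_iff of_nat_mult)
  ultimately have "M dvd j" by (simp add: coprime_dvd_mult_left_iff)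
  then show "j = 0" using j by (meson dvd_imp_le leD neq0_conv)
qed

lemma position_exists: "\<exists>k::int. \<exists>j<M. int t = k * int M + int j * int D"
proof -
  \<comment> \<open>As \<open>m * D\<close> is -1 modulo \<open>M\<close>, the inverse of \<open>D\<close> modulo \<open>M\<close> is \<open>M - m\<close>.\<close>
  define j where "j = (t * (M - m)) mod M"
  have "m \<le> M" using D unfolding M by (cases D) auto
  have "int (t * (M - m)) = int M * int (t * (M - m) div M) + int j"
    unfolding j_def by (metis of_nat_add of_nat_mult mult_div_mod_eq)
  then have "int t - int j * int D = int t - int (t * (M - m)) * int D + int M * (int (t * (M - m) div M) * int D)"
    by (simp add: algebra_simps)
  also have "int (t * (M - m)) * int D = int t * (int M * (int D - 1) + 1)"
  proof -
    have "(int M - int m) * int D = int M * (int D - 1) + 1" by (simp add: M algebra_simps)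
    then show ?thesis using \<open>m \<le> M\<close> by (simp only: of_nat_mult of_nat_diff mult.assoc)
  qed
  finally have "int t - int j * int D =
      int M * (int (t * (M - m) div M) * int D - int t * (int D - 1))"
    by (simp add: algebra_simps)
  then have "int t = (int (t * (M - m) div M) * int D - int t * (int D - 1)) * int M + int j * int D"
    by (simp add: algebra_simps)
  moreover have "j < M" unfolding j_def M by simp
  ultimately show ?thesis by blast
qed

text \<open>
  The \<open>k\<close>-th round since the marker appeared finds \<open>k - 1\<close> increments completed. The rounds with
  \<open>k \<le> 0\<close> belong to digits that are read before the first carry can have reached them.
\<close>
definition increments :: "int \<Rightarrow> nat" where "increments k = nat (k - 1)"

text \<open>
  Every time at which the marker is not read is \<open>k * M + j * D\<close> for some \<open>j\<close> with \<open>0 < j < M\<close>. Then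
  the \<open>j\<close>-th digit is read, and the carry of the \<open>k\<close>-th increment arrives. Going back by \<open>M\<close> means
  the same digit one increment earlier, and going back by \<open>D\<close> means the preceding digit during the
  same increment.
\<close>
lemma closed_form:
  assumes "0 < t" "0 < j" "j < M" "int t = k * int M + int j * int D"
  shows "W t = increments k div q ^ (j - 1) mod q \<and>
    (c t \<longleftrightarrow> 0 < k \<and> Suc (increments k) mod q ^ (j - 1) = 0)"
  using assms
proof (induction t arbitrary: k j rule: less_induct)
  case (less t)
  have jD: "int j * int D > 0" using less.prems D by simp
  have nonpos: "k \<le> 0" if "t \<le> M"
  proof (rule ccontr)
    assume "\<not> k \<le> 0"
    then have "k * int M \<ge> 1 * int M" by (intro mult_right_mono) auto
    then show False using jD less.prems(4) that by linarith
  qed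
  have W: "W t = increments k div q ^ (j - 1) mod q"
  proof (cases "t \<le> M")
    case True
    have "t \<noteq> M"
    proof
      assume "t = M"
      then have "int j * int D = int M * (1 - k)" using less.prems(4) by (simp add: algebra_simps)
      then have "int M dvd int j * int D" by simp
      then show False using dvd_mult_D less.prems by blast
    qed
    then show ?thesis using True nonpos W_zero[of t] less.prems(1) by (simp add: increments_def)
  next
    case False
    define s where "s = t - M"
    have s: "t = s + M" "0 < s" "s < t" "int s = (k - 1) * int M + int j * int D"
      using False less.prems M by (auto simp: s_def algebra_simps of_nat_diff)
    note IH = less.IH[OF s(3,2) less.prems(2,3) s(4)]
    have "W s < q" using IH q by simp
    then have *: "W t = (W s + of_bool (c s)) mod q"
      unfolding s(1) using s(2) by (simp add: W_step next_digit_def)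
    show ?thesis
    proof (cases "k \<ge> 2")
      case True
      then have v: "increments k = Suc (increments (k - 1))" by (simp add: increments_def nat_eq_iff Suc_nat_eq_nat_zadd1)
      show ?thesis unfolding * v using IH True q by (subst digit_Suc) auto
    next
      case False
      then have "increments k = 0" "increments (k - 1) = 0" by (auto simp: increments_def)
      then show ?thesis unfolding * using IH False by auto
    qed
  qed
  have "c t \<longleftrightarrow> 0 < k \<and> Suc (increments k) mod q ^ (j - 1) = 0"
  proof (cases "t \<le> D")
    case True
    moreover have "1 * D \<le> m * D" by (rule mult_le_mono1) (use m in simp)
    then have "D \<le> M" unfolding M by linarith
    ultimately show ?thesis using nonpos c_zero[of t] less.prems(1) by auto
  next
    case False
    define s where "s = t - D"
    have s: "t = s + D" "0 < s" "s < t" "int s = k * int M + int (j - 1) * int D"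
      using False less.prems D by (auto simp: s_def algebra_simps of_nat_diff)
    have *: "c t = carry_out q (W s) (c s)" unfolding s(1) using s(2) by (rule c_step)
    show ?thesis
    proof (cases "j = 1")
      case True
      then have "int s = k * int M" using s by simp
      have "k > 0"
      proof (rule ccontr)
        assume "\<not> k > 0"
        then have "k * int M \<le> 0" by (intro mult_nonpos_nonneg) auto
        then show False using \<open>int s = k * int M\<close> s(2) by linarith
      qed
      then have "int s = int (nat k * M)" using \<open>int s = k * int M\<close> by simp
      then have "s = nat k * M" by (simp only: of_nat_eq_iff)
      then show ?thesis using * mark[of "nat k"] True \<open>k > 0\<close> by (simp add: carry_out_def)
    next
      case j: False
      then have "0 < j - 1" "j - 1 < M" using less.prems by auto
      note IH = less.IH[OF s(3,2) this s(4)]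
      have "q ^ (j - 1) = q ^ (j - 1 - 1) * q" using j less.prems(2)
        by (metis One_nat_def Suc_pred \<open>0 < j - 1\<close> power_Suc2)
      then have "Suc (increments k) mod q ^ (j - 1) = 0 \<longleftrightarrow>
          Suc (increments k) mod q ^ (j - 1 - 1) = 0 \<and> Suc (increments k div q ^ (j - 1 - 1) mod q) = q"
        using carry_Suc[of "q ^ (j - 1 - 1)" q "increments k"] q by simp
      moreover have "W s \<noteq> q" using IH q by (metis mod_less_divisor less_irrefl zero_less_numeral order_less_le_trans)
      ultimately show ?thesis using * IH by (auto simp: carry_out_def)
    qed
  qed
  with W show ?case by blast
qed

text \<open>
  The marker forces a period to be a multiple of \<open>M\<close>, that is, a number of increments. The most
  significant digit keeps its value for \<open>q ^ (M - 2)\<close> successive increments and then changes.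
\<close>
lemma long_period:
  assumes \<Delta>: "0 < \<Delta>" and per: "\<And>t. t0 \<le> t \<Longrightarrow> W (t + \<Delta>) = W t"
  shows "q ^ (M - 2) \<le> \<Delta>"
proof -
  define Q where "Q = q ^ (M - 2)"
  have M2: "M \<ge> 2" using m D unfolding M by simp
  have "t0 * 1 \<le> t0 * M" using M2 by (intro mult_le_mono2) simp
  then have "t0 \<le> Suc t0 * M" unfolding mult_Suc by linarith
  then have "W (Suc t0 * M + \<Delta>) = q"
    using per mark[of "Suc t0"] by (metis zero_less_Suc)
  obtain k j where kj: "j < M" "int (Suc t0 * M + \<Delta>) = k * int M + int j * int D"
    using position_exists by blast
  have "j = 0"
  proof (rule ccontr)
    assume "j \<noteq> 0"
    then have "W (Suc t0 * M + \<Delta>) < q"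
      using closed_form[OF _ _ kj] q \<Delta> by simp
    with \<open>W (Suc t0 * M + \<Delta>) = q\<close> show False by simp
  qed
  then have "int \<Delta> = (k - int (Suc t0)) * int M" using kj by (simp add: algebra_simps)
  then obtain \<delta> where \<delta>: "\<Delta> = \<delta> * M"
    by (metis dvd_triv_right int_dvd_int_iff dvdE mult.commute)
  have "\<delta> > 0" using \<delta> \<Delta> by (cases \<delta>) auto
  have "Q > 0" using q by (simp add: Q_def)
  have "Q \<le> \<delta>"
  proof (rule ccontr)
    assume "\<not> Q \<le> \<delta>"
    \<comment> \<open>After \<open>v\<close> increments the most significant digit is 0 and about to become 1.\<close>
    define v where "v = t0 * (q * Q) + (Q - 1)"
    define t where "t = Suc v * M + (M - 1) * D"
    have qQ: "1 \<le> q * Q" using q \<open>Q > 0\<close> by simp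
    have "t0 * 1 \<le> t0 * (q * Q)" using qQ by (rule mult_le_mono2)
    then have "t0 \<le> v" unfolding v_def by linarith
    moreover have "v * 1 \<le> v * M" using M2 by (intro mult_le_mono2) simp
    ultimately have t: "t0 \<le> t" unfolding t_def mult_Suc by linarith
    have val: "increments (int (Suc v)) = v" "increments (int (Suc v + \<delta>)) = v + \<delta>" by (auto simp: increments_def)
    have "int t = int (Suc v) * int M + int (M - 1) * int D"
      unfolding t_def by (simp only: of_nat_add of_nat_mult)
    from closed_form[OF _ _ _ this] have "W t = v div Q mod q"
      unfolding val using M2 by (simp add: t_def Q_def numeral_2_eq_2)
    moreover have "int (t + \<Delta>) = int (Suc v + \<delta>) * int M + int (M - 1) * int D"
      unfolding t_def \<delta> by (simp only: of_nat_add of_nat_mult distrib_right)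
    from closed_form[OF _ _ _ this] have "W (t + \<Delta>) = (v + \<delta>) div Q mod q"
      unfolding val using M2 by (simp add: t_def Q_def numeral_2_eq_2)
    moreover have "v div Q mod q = 0"
    proof -
      have "v = (Q - 1) + (t0 * q) * Q" by (simp add: v_def)
      then have "v div Q = t0 * q" using \<open>Q > 0\<close> by (simp only: div_mult_self1) simp
      then show ?thesis by simp
    qed
    moreover have "(v + \<delta>) div Q mod q = 1"
    proof -
      have "v + \<delta> = (t0 * q + 1) * Q + (\<delta> - 1)"
        using \<open>Q > 0\<close> \<open>\<delta> > 0\<close> by (simp add: v_def algebra_simps)
      then have "(v + \<delta>) div Q = t0 * q + 1"
        using \<open>\<not> Q \<le> \<delta>\<close> \<open>Q > 0\<close> by (simp only: div_mult_self3) simp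
      then show ?thesis using q by (simp only: mod_mult_self3) simp
    qed
    ultimately show False using per[OF t] by simp
  qed
  also have "\<delta> \<le> \<Delta>" using \<delta> M2 by simp
  finally show ?thesis by (simp add: Q_def)
qed

end

section \<open>Shift registers around a monotone circuit\<close>

text \<open>
  The cells \<open>Cell r k\<close> form a shift register, the row \<open>r\<close>, whose last cell provides the signal of the
  row. \<open>Cast r\<close> is a binary tree that makes copies of this signal, and \<open>Form r\<close> is the tree of gates
  of a formula that computes what is fed into the row. Both are indexed by paths whose head is the
  step farthest from the root. The nodes \<open>Tree k i\<close>, with level \<open>k\<close>, spread the signal of one row,
  and the nodes \<open>Pad k\<close> fill the network up to the required dimension.
\<close>
datatype 'r node =
  Cell 'r nat | Cast 'r "bool list" | Form 'r "bool list" | Tree nat nat | Pad nat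

text \<open>
  Variables and constants are their own subformulas at every path. This pads all formulas to complete
  binary trees of equal height, so that all signals take the same time through the circuit.
\<close>
fun subformula_at :: "'r formula \<Rightarrow> bool list \<Rightarrow> 'r formula" where
  "subformula_at \<phi> [] = \<phi>"
| "subformula_at \<phi> (b # p) = (case subformula_at \<phi> p of
      Conj \<psi> \<psi>' \<Rightarrow> (if b then \<psi>' else \<psi>)
    | Disj \<psi> \<psi>' \<Rightarrow> (if b then \<psi>' else \<psi>)
    | \<psi> \<Rightarrow> \<psi>)"

lemma formula_depth_subformula_at: "formula_depth (subformula_at \<phi> p) \<le> formula_depth \<phi> - length p"
  by (induction p) (auto split: formula.splits)

lemma formula_vars_subformula_at: "formula_vars (subformula_at \<phi> p) \<subseteq> formula_vars \<phi>"
  by (induction p) (auto split: formula.splits)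

text \<open>
  Rows without a timer are fed by their formula, and \<open>timer r = Some b\<close> makes \<open>r\<close> a ladder fed with
  the constant \<open>b\<close>. The signal of \<open>tap\<close> is spread by the tree, whose last level \<open>d\<close> has \<open>L + 1\<close> nodes.
\<close>
locale machine =
  fixes rows :: "'r list" and len :: "'r \<Rightarrow> nat" and timer :: "'r \<Rightarrow> bool option"
    and \<phi> :: "'r \<Rightarrow> 'r formula" and H :: nat and tap :: 'r and L d N :: nat
  assumes vars: "\<And>r. r \<in> set rows \<Longrightarrow> formula_vars (\<phi> r) \<subseteq> set rows"
    and depth: "\<And>r. r \<in> set rows \<Longrightarrow> formula_depth (\<phi> r) \<le> H"
    and tap: "tap \<in> set rows"
    and L: "L < 2 ^ d"
begin

text \<open>
  The leaf at path \<open>p\<close> of the formula of \<open>r\<close> reads the copy at path \<open>p @ address r\<close>. As addresses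
  differ in different rows and have equal lengths, no copy is read twice.
\<close>
definition address :: "'r \<Rightarrow> bool list" where
  "address r = map (\<lambda>r'. r' = r) rows"

lemma length_address [simp]: "length (address r) = length rows"
  by (simp add: address_def)

lemma address_inj: "address r = address r' \<Longrightarrow> r \<in> set rows \<Longrightarrow> r = r'"
  by (auto simp: address_def)

abbreviation cast_depth :: nat where "cast_depth \<equiv> H + length rows"

fun gate :: "'r node \<Rightarrow> 'r node gate" where
  \<comment> \<open>Cell 1 of a ladder is a copy of cell 0, as \<open>1 - 2 = 0\<close> on natural numbers.\<close>
  "gate (Cell r k) = (case timer r of
      None \<Rightarrow> Copy (if k = 0 then Form r [] else Cell r (k - 1))
    | Some b \<Rightarrow> if k = 0 then Const b
        else if b then And (Cell r (k - 1)) (Cell r (k - 2))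
        else Or (Cell r (k - 1)) (Cell r (k - 2)))"
| "gate (Cast r []) = Copy (Cell r (len r))"
| "gate (Cast r (b # p)) = Copy (Cast r p)"
| "gate (Form r p) =
    (if length p < H then
      (case subformula_at (\<phi> r) p of
        Disj _ _ \<Rightarrow> Or (Form r (False # p)) (Form r (True # p))
      | _ \<Rightarrow> And (Form r (False # p)) (Form r (True # p)))
    else
      (case subformula_at (\<phi> r) p of
        Var r' \<Rightarrow> Copy (Cast r' (p @ address r))
      | Cst b \<Rightarrow> Const b
      | _ \<Rightarrow> Const False))"
| "gate (Tree k i) = Copy (if k = 0 then Cell tap (len tap) else Tree (k - 1) (i div 2))"
| "gate (Pad k) = Const False"

definition cells :: "'r node set" where
  "cells = (\<Union>r\<in>set rows. Cell r ` {..len r})"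
definition casts :: "'r node set" where
  "casts = (\<Union>r\<in>set rows. Cast r ` {p. length p \<le> cast_depth})"
definition forms :: "'r node set" where
  "forms = (\<Union>r\<in>set rows. Form r ` {p. length p \<le> H})"
definition trees :: "'r node set" where
  "trees = (\<Union>k\<le>d. Tree k ` {..L div 2 ^ (d - k)})"
definition working_nodes :: "'r node set" where
  "working_nodes = cells \<union> casts \<union> forms \<union> trees"
definition nodes :: "'r node set" where
  "nodes = working_nodes \<union> Pad ` {..<N - card working_nodes}"

lemmas node_defs = nodes_def working_nodes_def cells_def casts_def forms_def trees_def

lemma nodes_iff [simp]:
  "Cell r k \<in> nodes \<longleftrightarrow> r \<in> set rows \<and> k \<le> len r"
  "Cast r p \<in> nodes \<longleftrightarrow> r \<in> set rows \<and> length p \<le> cast_depth"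
  "Form r p \<in> nodes \<longleftrightarrow> r \<in> set rows \<and> length p \<le> H"
  "Tree k i \<in> nodes \<longleftrightarrow> k \<le> d \<and> i \<le> L div 2 ^ (d - k)"
  "Pad k \<in> nodes \<longleftrightarrow> k < N - card working_nodes"
  by (auto simp: node_defs)

lemma finite_paths: "finite {p :: bool list. length p \<le> n}"
  using finite_lists_length_le[of "UNIV :: bool set" n] by simp

lemma card_paths: "card {p :: bool list. length p \<le> n} \<le> 2 ^ Suc n"
proof -
  have "card {p :: bool list. length p \<le> n} = (\<Sum>i\<le>n. 2 ^ i)"
    using card_lists_length_le[of "UNIV :: bool set" n] by simp
  also have "(\<Sum>i\<le>n. 2 ^ i) \<le> (2::nat) ^ Suc n"
    by (induction n) auto
  finally show ?thesis .
qed

lemma finite_nodes: "finite nodes"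
  by (auto simp: node_defs finite_paths)

lemma tree_parent:
  assumes "Suc k \<le> d" "i \<le> L div 2 ^ (d - Suc k)"
  shows "i div 2 \<le> L div 2 ^ (d - k)"
proof -
  have "d - k = Suc (d - Suc k)" using assms by simp
  then have "L div 2 ^ (d - k) = L div 2 ^ (d - Suc k) div 2"
    by (simp only: power_Suc2 div_mult2_eq)
  then show ?thesis using assms(2) div_le_mono by metis
qed

lemma inputs_in_nodes:
  assumes "v \<in> nodes"
  shows "gate_inputs (gate v) \<subseteq> nodes"
proof (cases v)
  case (Cell r k)
  then show ?thesis using assms by (auto split: option.splits)
next
  case (Cast r p)
  then show ?thesis using assms by (cases p) auto
next
  case (Form r p)
  show ?thesis
  proof (cases "length p < H")
    case True
    then show ?thesis using assms Form by (auto split: formula.splits)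
  next
    case False
    moreover have "formula_vars (subformula_at (\<phi> r) p) \<subseteq> set rows"
      using assms Form vars formula_vars_subformula_at by fastforce
    ultimately show ?thesis using assms Form by (auto split: formula.splits)
  qed
next
  case (Tree k i)
  then show ?thesis using assms tap tree_parent[of "k - 1" i] by (cases k) auto
qed simp

text \<open>
  Only the end of a row is read from outside the row, by the root of its copying tree and, for the row
  \<open>tap\<close>, by the root of the spreading tree; the cells before it are read by at most two later cells.
  All other nodes belong to trees, and a leaf of a copying tree has at most one reader since its path
  determines the address.
\<close>
lemma fanout:
  assumes u: "u \<in> nodes"
  shows "card {v \<in> nodes. u \<in> gate_inputs (gate v)} \<le> 2"
proof -
  have two: ?thesis if "\<And>v. v \<in> nodes \<Longrightarrow> u \<in> gate_inputs (gate v) \<Longrightarrow> v \<in> {x, y}" for x y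
  proof -
    have "card {v \<in> nodes. u \<in> gate_inputs (gate v)} \<le> card {x, y}"
      using that by (intro card_mono) auto
    also have "\<dots> \<le> 2" by (simp add: card_insert_if)
    finally show ?thesis .
  qed
  show ?thesis
  proof (cases u)
    case (Cell r k)
    show ?thesis
    proof (cases "k = len r")
      case True
      show ?thesis
      proof (rule two)
        fix v assume "v \<in> nodes" "u \<in> gate_inputs (gate v)"
        then show "v \<in> {Cast r [], Tree 0 0}" unfolding Cell True
          using L by (cases v rule: gate.cases)
            (auto split: option.splits formula.splits if_splits)
      qed
    next
      case False
      show ?thesis
      proof (rule two)
        fix v assume "v \<in> nodes" "u \<in> gate_inputs (gate v)"
        then show "v \<in> {Cell r (Suc k), Cell r (Suc (Suc k))}" unfolding Cell
          using False by (cases v rule: gate.cases)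
            (auto split: option.splits formula.splits if_splits)
      qed
    qed
  next
    case (Cast r p)
    show ?thesis
    proof (cases "length p < cast_depth")
      case True
      show ?thesis
      proof (rule two)
        fix v assume "v \<in> nodes" "u \<in> gate_inputs (gate v)"
        then show "v \<in> {Cast r (False # p), Cast r (True # p)}" unfolding Cast
          using True by (cases v rule: gate.cases)
            (auto split: option.splits formula.splits if_splits)
      qed
    next
      case False
      have leaf: "\<exists>s p'. v = Form s p' \<and> s \<in> set rows \<and> length p' = H \<and> p = p' @ address s"
        if "v \<in> nodes" "u \<in> gate_inputs (gate v)" for v
        using that False unfolding Cast by (cases v rule: gate.cases)
            (auto split: option.splits formula.splits if_splits)
      show ?thesis
      proof (cases "\<exists>v\<in>nodes. u \<in> gate_inputs (gate v)")
        case True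
        then obtain v where v: "v \<in> nodes" "u \<in> gate_inputs (gate v)" by blast
        show ?thesis
        proof (rule two)
          fix w assume "w \<in> nodes" "u \<in> gate_inputs (gate w)"
          then obtain s p' where w: "w = Form s p'" "s \<in> set rows" "length p' = H" "p = p' @ address s"
            using leaf by blast
          obtain s'' p'' where v': "v = Form s'' p''" "length p'' = H" "p = p'' @ address s''"
            using leaf[OF v] by blast
          have "p' = p''" "address s = address s''"
            using w v' append_eq_append_conv[of p' p'' "address s" "address s''"] by simp_all
          then show "w \<in> {v, v}" using w(1,2) v'(1) address_inj by simp
        qed
      next
        case False
        then have "{v \<in> nodes. u \<in> gate_inputs (gate v)} = {}" by blast
        then show ?thesis by (metis card.empty zero_le)
      qed
    qed
  next
    case (Form r p)
    show ?thesis
    proof (rule two)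
      fix v assume "v \<in> nodes" "u \<in> gate_inputs (gate v)"
      then show "v \<in> {Cell r 0, Form r (tl p)}" unfolding Form
        by (cases v rule: gate.cases)
          (auto split: option.splits formula.splits if_splits)
    qed
  next
    case (Tree k i)
    show ?thesis
    proof (rule two)
      fix v assume "v \<in> nodes" "u \<in> gate_inputs (gate v)"
      then show "v \<in> {Tree (Suc k) (2 * i), Tree (Suc k) (2 * i + 1)}" unfolding Tree
        by (cases v rule: gate.cases)
          (auto split: option.splits formula.splits if_splits)
    qed
  next
    case (Pad k)
    have "v \<notin> nodes \<or> u \<notin> gate_inputs (gate v)" for v unfolding Pad
      by (cases v rule: gate.cases)
          (auto split: option.splits formula.splits if_splits)
    then have "{v \<in> nodes. u \<in> gate_inputs (gate v)} = {}" by blast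
    then show ?thesis by (metis card.empty zero_le)
  qed
qed

text \<open>
  The levels halve in size up to rounding, so the whole tree is about twice as large as its last
  level.
\<close>
lemma card_trees: "card trees \<le> 2 * L + Suc d"
proof -
  have "card trees \<le> (\<Sum>k\<le>d. card (Tree k ` {..L div 2 ^ (d - k)} :: 'r node set))"
    unfolding trees_def by (rule card_UN_le) simp
  also have "\<dots> \<le> (\<Sum>k\<le>d. L div 2 ^ (d - k) + 1)"
    by (intro sum_mono order_trans[OF card_image_le]) auto
  also have "\<dots> = (\<Sum>k\<le>d. L div 2 ^ (d - k)) + Suc d"
    by (simp only: sum.distrib) simp
  also have "(\<Sum>k\<le>d. L div 2 ^ (d - k)) = (\<Sum>k\<le>d. L div 2 ^ k)"
    using sum.atLeastAtMost_rev[of "\<lambda>k. L div 2 ^ k" 0 d]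
    by (simp add: atMost_atLeast0)
  also have "(\<Sum>k\<le>d. L div 2 ^ k) \<le> 2 * L"
  proof -
    have "(\<Sum>k\<le>n. l div 2 ^ k) \<le> 2 * l" for n l :: nat
    proof (induction n arbitrary: l)
      case (Suc n)
      have "(\<Sum>k\<le>Suc n. l div 2 ^ k) = l + (\<Sum>k\<le>n. l div 2 div 2 ^ k)"
        by (subst sum.atMost_Suc_shift) (simp add: div_mult2_eq)
      also have "\<dots> \<le> l + 2 * (l div 2)" using Suc[of "l div 2"] by simp
      finally show ?case by simp
    qed simp
    then show ?thesis .
  qed
  finally show ?thesis by simp
qed

lemma card_cells: "distinct rows \<Longrightarrow> card cells \<le> (\<Sum>r\<in>set rows. Suc (len r))"
  unfolding cells_def
  by (intro order_trans[OF card_UN_le] sum_mono order_trans[OF card_image_le]) auto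

lemma card_casts: "card casts \<le> length rows * 2 ^ Suc cast_depth"
proof -
  have "card casts \<le> (\<Sum>r\<in>set rows. 2 ^ Suc cast_depth)"
    unfolding casts_def
    by (intro order_trans[OF card_UN_le] sum_mono order_trans[OF card_image_le] card_paths finite_paths) auto
  also have "\<dots> = card (set rows) * 2 ^ Suc cast_depth" by simp
  also have "\<dots> \<le> length rows * 2 ^ Suc cast_depth" by (intro mult_le_mono1 card_length)
  finally show ?thesis .
qed

lemma card_forms: "card forms \<le> length rows * 2 ^ Suc H"
proof -
  have "card forms \<le> (\<Sum>r\<in>set rows. 2 ^ Suc H)"
    unfolding forms_def
    by (intro order_trans[OF card_UN_le] sum_mono order_trans[OF card_image_le] card_paths finite_paths) auto
  also have "\<dots> = card (set rows) * 2 ^ Suc H" by simp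
  also have "\<dots> \<le> length rows * 2 ^ Suc H" by (intro mult_le_mono1 card_length)
  finally show ?thesis .
qed

lemma card_nodes:
  assumes "card working_nodes \<le> N"
  shows "card nodes = N"
proof -
  have "card nodes = card working_nodes + card (Pad ` {..<N - card working_nodes} :: 'r node set)"
    unfolding nodes_def
    by (intro card_Un_disjoint) (auto simp: working_nodes_def cells_def casts_def forms_def trees_def finite_paths)
  also have "card (Pad ` {..<N - card working_nodes} :: 'r node set) = N - card working_nodes"
    by (subst card_image) (auto simp: inj_on_def)
  finally show ?thesis using assms by simp
qed

text \<open>
  The signal passes \<open>H + length rows\<close> edges of a copying tree and \<open>H\<close> edges of a formula. The entries to
  the copying tree, to the formula and to the row take one step each.
\<close>
definition latency :: nat where "latency = 2 * H + length rows + 3"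

definition row_end :: "(nat \<Rightarrow> 'r node \<Rightarrow> bool) \<Rightarrow> nat \<Rightarrow> 'r \<Rightarrow> bool" where
  "row_end S t r = S t (Cell r (len r))"

definition is_run :: "(nat \<Rightarrow> 'r node \<Rightarrow> bool) \<Rightarrow> bool" where
  "is_run S \<longleftrightarrow> (\<forall>t. \<forall>v\<in>nodes. S (Suc t) v = gate_val (gate v) (S t))"

context
  fixes S assumes run: "is_run S"
begin

lemma step: "v \<in> nodes \<Longrightarrow> S (Suc t) v = gate_val (gate v) (S t)"
  using run by (simp add: is_run_def)

lemma cast_val:
  "r \<in> set rows \<Longrightarrow> length p \<le> cast_depth \<Longrightarrow> S (Suc (t + length p)) (Cast r p) = row_end S t r"
proof (induction p)
  case Nil
  then show ?case by (simp add: step row_end_def)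
next
  case (Cons b p)
  then show ?case by (simp add: step)
qed

lemma form_val:
  assumes "r \<in> set rows" "length p + n = H"
  shows "S (t + cast_depth + 2 + n) (Form r p) = formula_val (subformula_at (\<phi> r) p) (row_end S t)"
  using assms(2)
proof (induction n arbitrary: p)
  case 0
  have "formula_depth (subformula_at (\<phi> r) p) = 0"
    using formula_depth_subformula_at[of "\<phi> r" p] depth[OF assms(1)] 0 by simp
  moreover have "formula_vars (subformula_at (\<phi> r) p) \<subseteq> set rows"
    using formula_vars_subformula_at vars[OF assms(1)] by fast
  moreover have "S (Suc (t + cast_depth)) (Cast s (p @ address r)) = row_end S t s" if "s \<in> set rows" for s
    using cast_val[of s "p @ address r" t] that 0 by (simp add: add.assoc)
  ultimately show ?case using 0 assms(1)
    by (cases "subformula_at (\<phi> r) p") (auto simp: step)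
next
  case (Suc n)
  have IH: "S (t + cast_depth + 2 + n) (Form r (b # p)) =
      formula_val (subformula_at (\<phi> r) (b # p)) (row_end S t)" for b
    using Suc by simp
  have "S (t + cast_depth + 2 + Suc n) (Form r p) = gate_val (gate (Form r p)) (S (t + cast_depth + 2 + n))"
    using Suc.prems assms(1) step[of "Form r p" "t + cast_depth + 2 + n"] by simp
  then show ?case using IH[of True] IH[of False] Suc.prems
    by (cases "subformula_at (\<phi> r) p") auto
qed

lemma cell_val:
  assumes "r \<in> set rows" "timer r = None" "k \<le> len r"
  shows "S (t + k) (Cell r k) = S t (Cell r 0)"
  using assms(3)
proof (induction k)
  case (Suc k)
  then show ?case using assms by (simp add: step)
qed simp

lemma row_end_initial:
  assumes "r \<in> set rows" "timer r = None" "t \<le> len r"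
  shows "row_end S t r = S 0 (Cell r (len r - t))"
proof -
  have "S (t + 0) (Cell r (k + t)) = S 0 (Cell r k)" if "k + t \<le> len r" for k
    using that
  proof (induction t)
    case (Suc t)
    then show ?case using assms by (simp add: step)
  qed simp
  from this[of "len r - t"] show ?thesis using assms(3) by (simp add: row_end_def)
qed

lemma row_end_step:
  assumes "r \<in> set rows" "timer r = None"
  shows "row_end S (t + latency + len r) r = formula_val (\<phi> r) (row_end S t)"
proof -
  have "row_end S (t + latency + len r) r = S (t + latency) (Cell r 0)"
    using cell_val[OF assms, of "len r"] by (simp add: row_end_def)
  also have "\<dots> = S (t + cast_depth + 2 + H) (Form r [])"
  proof -
    have *: "t + latency = Suc (t + cast_depth + 2 + H)" by (simp add: latency_def)
    show ?thesis unfolding * using step[of "Cell r 0" "t + cast_depth + 2 + H"] assms by simp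
  qed
  also have "\<dots> = formula_val (\<phi> r) (row_end S t)"
    using form_val[OF assms(1), of "[]" H t] by simp
  finally show ?thesis .
qed

text \<open>
  Information moves up a ladder by one or two cells per step. Hence after \<open>t\<close> steps cell \<open>k\<close> combines
  the initial values of the cells \<open>k - 2 * t, \<dots>, k - t\<close>, so that a single cell with the wrong value
  keeps it from switching. Once \<open>t > k\<close>, only the constant is left.
\<close>
lemma ladder_val:
  assumes "r \<in> set rows" "timer r = Some b" "k \<le> len r"
  shows "S t (Cell r k) = b \<longleftrightarrow> k < t \<or> (\<forall>j. k - 2 * t \<le> j \<and> j \<le> k - t \<longrightarrow> S 0 (Cell r j) = b)"
  using assms(3)
proof (induction t arbitrary: k)
  case 0
  show ?case by auto
next
  case (Suc t)
  consider "k = 0" | "k = 1" | "2 \<le> k" by linarith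
  then show ?case
  proof cases
    case 1
    then show ?thesis using assms by (simp add: step)
  next
    case 2
    then have "S (Suc t) (Cell r k) = S t (Cell r 0)"
      using assms Suc.prems by (cases b) (simp_all add: step)
    then show ?thesis using Suc.IH[of 0] 2 by (cases "t = 0") auto
  next
    case 3
    have "S (Suc t) (Cell r k) = b \<longleftrightarrow> S t (Cell r (k - 1)) = b \<and> S t (Cell r (k - 2)) = b"
      using assms Suc.prems 3 by (cases b) (simp_all add: step)
    also have "\<dots> \<longleftrightarrow> (k - 1 < t \<or> (\<forall>j. k - 1 - 2 * t \<le> j \<and> j \<le> k - 1 - t \<longrightarrow> S 0 (Cell r j) = b)) \<and>
        (k - 2 < t \<or> (\<forall>j. k - 2 - 2 * t \<le> j \<and> j \<le> k - 2 - t \<longrightarrow> S 0 (Cell r j) = b))"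
      using Suc.IH[of "k - 1"] Suc.IH[of "k - 2"] Suc.prems by simp
    also have "\<dots> \<longleftrightarrow> k < Suc t \<or> (\<forall>j. k - 2 * Suc t \<le> j \<and> j \<le> k - Suc t \<longrightarrow> S 0 (Cell r j) = b)"
    proof -
      consider "k \<le> t" | "k = Suc t" | "k \<ge> t + 2" by linarith
      then show ?thesis
      proof cases
        case 1
        then have "k - 1 < t" "k - 2 < t" "k < Suc t" using 3 by linarith+
        then show ?thesis by simp
      next
        case 2
        then have "\<not> k - 1 < t" "k - 2 < t" "\<not> k < Suc t" "k - 1 - 2 * t = 0" "k - 1 - t = 0"
          "k - 2 * Suc t = 0" "k - Suc t = 0" using 3 by simp_all
        then show ?thesis by simp
      next
        case c: 3
        have "k - 2 * Suc t \<le> j \<and> j \<le> k - Suc t \<longleftrightarrow>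
            (k - 1 - 2 * t \<le> j \<and> j \<le> k - 1 - t) \<or> (k - 2 - 2 * t \<le> j \<and> j \<le> k - 2 - t)" for j
        proof -
          define a b a' where "a = k - 2 - 2 * t" and "b = k - 2 - t" and "a' = k - 1 - 2 * t"
          have "k - 2 * Suc t = a" "k - Suc t = Suc b" "k - 1 - t = Suc b"
            using c by (simp_all add: a_def b_def)
          moreover have "a' = a \<or> a' = Suc a" "a \<le> b"
            using c by (auto simp: a_def b_def a'_def)
          ultimately show ?thesis unfolding a_def[symmetric] b_def[symmetric] a'_def[symmetric]
            by auto
        qed
        moreover have "\<not> k - 1 < t" "\<not> k - 2 < t" "\<not> k < Suc t" using c by linarith+
        ultimately show ?thesis by auto
      qed
    qed
    finally show ?thesis .
  qed
qed

lemma tree_val: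
  "k \<le> d \<Longrightarrow> i \<le> L div 2 ^ (d - k) \<Longrightarrow> S (Suc (t + k)) (Tree k i) = row_end S t tap"
proof (induction k arbitrary: i)
  case 0
  then show ?case by (simp add: step row_end_def)
next
  case (Suc k)
  then show ?case using tree_parent[of k i] by (simp add: step)
qed

end

end

section \<open>The control logic of the counter\<close>

text \<open>
  The rows \<open>Main i\<close> hold the digits, one bit each, and the rows \<open>Rec j\<close> hold the records. The carry is
  stored together with its complement, as \<open>Car b\<close> says that the carry equals \<open>b\<close>. The rows
  \<open>Tim pol late i\<close> are timers that switch to the value \<open>pol\<close>, at time \<open>M\<close> or one step later.
\<close>
datatype row = Main nat | Rec nat | Car bool | Tim bool bool nat

text \<open>
  The words of the code are subsets of \<open>{..<l}\<close>: the digits \<open>0, \<dots>, q - 1\<close> and the marker \<open>q\<close>. The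
  records compare the number of ones in a word with the thresholds \<open>lo, \<dots>, lo + r - 1\<close>.
\<close>
locale antichain_code =
  fixes l r h q lo :: nat and code :: "nat \<Rightarrow> nat set"
  assumes q: "2 \<le> q" and r: "0 < r"
    and code_sub: "\<And>d. d \<le> q \<Longrightarrow> code d \<subseteq> {..<l}"
    and antichain: "\<And>d d'. d \<le> q \<Longrightarrow> d' \<le> q \<Longrightarrow> code d \<subseteq> code d' \<Longrightarrow> d = d'"
begin

definition word :: "(row \<Rightarrow> bool) \<Rightarrow> nat set" where
  "word x = {i. i < l \<and> x (Main i)}"

definition fired :: "bool \<Rightarrow> (row \<Rightarrow> bool) \<Rightarrow> bool" where
  "fired late x \<longleftrightarrow> (\<forall>i<h. x (Tim True late i))"

definition waiting :: "bool \<Rightarrow> (row \<Rightarrow> bool) \<Rightarrow> bool" where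
  "waiting late x \<longleftrightarrow> (\<exists>i<h. x (Tim False late i))"

text \<open>
  There are three phases. Before time \<open>M\<close> both timers wait: digits 0 are written, and the
  discarded words are recorded. At time \<open>M\<close> only the early timer has fired, and the marker is written. Later
  both have fired, and the counter runs. From time \<open>M\<close> on, the contents of each record row are fed
  into the next one, so that in the course of \<open>r\<close> rounds every record passes \<open>Rec 0\<close>. Asking for a
  codeword below the current word, instead of a codeword equal to it, makes the function monotone.
\<close>
fun logic :: "row \<Rightarrow> (row \<Rightarrow> bool) \<Rightarrow> bool" where
  "logic (Main i) x \<longleftrightarrow>
      waiting False x \<and> i \<in> code 0 \<or>
      fired False x \<and> waiting True x \<and> i \<in> code q \<or>
      fired True x \<and> (\<exists>d\<le>q. \<exists>c. code d \<subseteq> word x \<and> x (Car c) \<and> i \<in> code (next_digit q d c))"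
| "logic (Car b) x \<longleftrightarrow>
      waiting True x \<and> \<not> b \<or>
      fired True x \<and> (\<exists>d\<le>q. \<exists>c. code d \<subseteq> word x \<and> x (Car c) \<and> b = carry_out q d c)"
| "logic (Rec j) x \<longleftrightarrow>
      waiting False x \<and> lo + j < card (word x) \<or>
      fired False x \<and> x (Rec (if j = 0 then r - 1 else j - 1))"
| "logic (Tim pol late i) x \<longleftrightarrow> False"

definition rows :: "row list" where
  "rows = map Main [0..<l] @ map Rec [0..<r] @ [Car False, Car True] @
     map (Tim False False) [0..<h] @ map (Tim False True) [0..<h] @
     map (Tim True False) [0..<h] @ map (Tim True True) [0..<h]"

lemma rows_iff [simp]:
  "Main i \<in> set rows \<longleftrightarrow> i < l"
  "Rec j \<in> set rows \<longleftrightarrow> j < r"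
  "Car b \<in> set rows"
  "Tim pol late i \<in> set rows \<longleftrightarrow> i < h"
  by (cases b, auto simp: rows_def) (cases pol; cases late; auto)+

lemma distinct_rows: "distinct rows"
  by (auto simp: rows_def distinct_map inj_on_def)

lemma length_rows: "length rows = l + r + 2 + 4 * h"
  by (simp add: rows_def)

lemma word_mono: "x \<le> y \<Longrightarrow> word x \<subseteq> word y"
  by (auto simp: word_def le_fun_def)

lemma logic_mono: "mono (logic a)"
proof (rule monoI)
  fix x y :: "row \<Rightarrow> bool" assume le: "x \<le> y"
  have x: "x a \<Longrightarrow> y a" for a using le by (auto simp: le_fun_def)
  have f: "fired late x \<Longrightarrow> fired late y" and w: "waiting late x \<Longrightarrow> waiting late y" for late
    using x by (auto simp: fired_def waiting_def)
  have "card (word x) \<le> card (word y)"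
    using word_mono[OF le] by (intro card_mono) (auto simp: word_def)
  then have th: "n < card (word x) \<Longrightarrow> n < card (word y)" for n by (rule order_less_le_trans[rotated])
  have cw: "code d \<subseteq> word x \<Longrightarrow> code d \<subseteq> word y" for d using word_mono[OF le] by (rule order_trans[rotated])
  have "logic a x \<Longrightarrow> logic a y"
  proof (cases a)
    case (Main i)
    show "logic a x \<Longrightarrow> logic a y"
      unfolding Main logic.simps using f w cw x[of "Car _"] by (elim disjE conjE exE) blast+
  next
    case (Car b)
    show "logic a x \<Longrightarrow> logic a y"
      unfolding Car logic.simps using f w cw x[of "Car _"] by (elim disjE conjE exE) blast+
  next
    case (Rec j)
    show "logic a x \<Longrightarrow> logic a y"
      unfolding Rec logic.simps using f w th x by (elim disjE conjE) blast+
  qed simp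
  then show "logic a x \<le> logic a y" by simp
qed

lemma logic_cong:
  assumes "a \<in> set rows" "\<And>b. b \<in> set rows \<Longrightarrow> x b = y b"
  shows "logic a x = logic a y"
proof -
  have "word x = word y" "fired late x = fired late y" "waiting late x = waiting late y" for late
    using assms(2) by (auto simp: word_def fired_def waiting_def)
  moreover have "x (Car b) = y (Car b)" for b using assms(2) by simp
  moreover have "x (Rec (if j = 0 then r - 1 else j - 1)) = y (Rec (if j = 0 then r - 1 else j - 1))"
    if "j < r" for j using assms(2) that r by simp
  ultimately show ?thesis using assms(1) by (cases a) simp_all
qed

text \<open>
  This is where the antichain enters: below a codeword there is no other codeword.
\<close>
lemma logic_active:
  assumes "d \<le> q" "word x = code d" "\<And>b. x (Car b) = (b = c)"
    and "fired True x" "\<not> waiting False x" "\<not> waiting True x"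
  shows "logic (Main i) x \<longleftrightarrow> i \<in> code (next_digit q d c)"
    and "logic (Car b) x \<longleftrightarrow> b = carry_out q d c"
proof -
  have "e = d" if "e \<le> q" "code e \<subseteq> word x" for e
    using that assms antichain by simp
  then show "logic (Main i) x \<longleftrightarrow> i \<in> code (next_digit q d c)"
    and "logic (Car b) x \<longleftrightarrow> b = carry_out q d c"
    using assms by auto
qed

end

text \<open>
  The recurrences that the signals \<open>x t\<close> of the rows satisfy when the timers work as intended.
\<close>
locale counter_run = antichain_code +
  fixes D m M :: nat and x :: "nat \<Rightarrow> row \<Rightarrow> bool"
  assumes D: "0 < D" and m: "0 < m" and M: "M = m * D + 1"
    and main_step: "\<And>t i. i < l \<Longrightarrow> x (t + M) (Main i) = logic (Main i) (x t)"
    and rec_step: "\<And>t j. j < r \<Longrightarrow> x (t + M) (Rec j) = logic (Rec j) (x t)"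
    and car_step: "\<And>t b. x (t + D) (Car b) = logic (Car b) (x t)"
    and fired: "\<And>t late. fired late (x t) \<longleftrightarrow> (if late then M < t else M \<le> t)"
    and waiting: "\<And>t late. waiting late (x t) \<longleftrightarrow> \<not> fired late (x t)"
begin

lemma D_le_M: "D \<le> M"
proof -
  have "1 * D \<le> m * D" by (rule mult_le_mono1) (use m in simp)
  then show ?thesis unfolding M by linarith
qed

lemma word_step: "word (x (t + M)) = {i. i < l \<and> logic (Main i) (x t)}"
  by (auto simp: word_def main_step)

lemma word_of_digit: "d \<le> q \<Longrightarrow> {i. i < l \<and> i \<in> code d} = code d"
  using code_sub by auto

lemma next_digit_le: "next_digit q d c \<le> q"
  using q by (auto simp: next_digit_def intro: less_imp_le)

lemma word_zero: "0 < t \<Longrightarrow> t < M \<Longrightarrow> word (x (M + t)) = code 0"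
  unfolding add.commute[of M] word_step using word_of_digit[of 0]
  by (simp add: fired waiting)

lemma word_mark: "word (x (M + M)) = code q"
  unfolding word_step using word_of_digit[of q]
  by (simp add: fired waiting)

lemma car_zero:
  assumes "0 < t" "t \<le> D"
  shows "x (M + t) (Car b) \<longleftrightarrow> b = False"
proof -
  have "M + t = (M + t - D) + D" using D_le_M by simp
  moreover have "M + t - D \<le> M" using assms by simp
  ultimately show ?thesis
    using car_step[of "M + t - D" b] by (simp add: fired waiting)
qed

definition carry :: "nat \<Rightarrow> bool" where "carry t = x (M + t) (Car True)"
definition digit :: "nat \<Rightarrow> nat" where "digit t = (THE d. d \<le> q \<and> word (x (M + t)) = code d)"

lemma digit_eqI: "d \<le> q \<Longrightarrow> word (x (M + t)) = code d \<Longrightarrow> digit t = d"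
  unfolding digit_def by (rule the_equality) (auto intro: antichain)

lemma active_step:
  assumes "0 < t" "d \<le> q" "word (x (M + t)) = code d" "\<And>b. x (M + t) (Car b) = (b = c)"
  shows "word (x (M + (t + M))) = code (next_digit q d c)"
    and "x (M + (t + D)) (Car b) = (b = carry_out q d c)"
proof -
  have phase: "fired True (x (M + t))" "\<not> waiting False (x (M + t))" "\<not> waiting True (x (M + t))"
    using assms(1) by (simp_all add: fired waiting)
  note act = logic_active[OF assms(2-4) phase]
  show "word (x (M + (t + M))) = code (next_digit q d c)"
    unfolding add.assoc[symmetric] word_step act(1) by (rule word_of_digit[OF next_digit_le])
  show "x (M + (t + D)) (Car b) = (b = carry_out q d c)"
    unfolding add.assoc[symmetric] car_step by (rule act(2))
qed

text \<open>
  From time \<open>M + 1\<close> on all words are in the code and the two carry rows are complementary: the words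
  read in the first round of the counter were written in the earlier phases, and the counter
  preserves both properties.
\<close>
lemma valid:
  "0 < t \<Longrightarrow> digit t \<le> q \<and> word (x (M + t)) = code (digit t) \<and> (\<forall>b. x (M + t) (Car b) = (b = carry t))"
proof (induction t rule: less_induct)
  case (less t)
  have "\<exists>d\<le>q. word (x (M + t)) = code d"
  proof -
    consider "t < M" | "t = M" | "M < t" by linarith
    then show ?thesis
    proof cases
      case 1
      then show ?thesis using word_zero less.prems by blast
    next
      case 2
      then show ?thesis using word_mark by blast
    next
      case 3
      then have pos: "0 < t - M" and less: "t - M < t" and t: "t - M + M = t" using M by auto
      note IH = less.IH[OF less pos]
      have "word (x (M + (t - M + M))) = code (next_digit q (digit (t - M)) (carry (t - M)))"
        using active_step(1)[OF pos IH[THEN conjunct1] IH[THEN conjunct2, THEN conjunct1]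
          IH[THEN conjunct2, THEN conjunct2, rule_format]] .
      then show ?thesis unfolding t using next_digit_le by (intro exI conjI)
    qed
  qed
  then have "digit t \<le> q \<and> word (x (M + t)) = code (digit t)" using digit_eqI by metis
  moreover have "\<exists>c. \<forall>b. x (M + t) (Car b) = (b = c)"
  proof (cases "t \<le> D")
    case True
    have "\<forall>b. x (M + t) (Car b) = (b = False)" using car_zero[OF less.prems True] by simp
    then show ?thesis by (rule exI)
  next
    case False
    then have pos: "0 < t - D" and less: "t - D < t" and t: "t - D + D = t" using D by auto
    note IH = less.IH[OF less pos]
    have "\<forall>b. x (M + (t - D + D)) (Car b) = (b = carry_out q (digit (t - D)) (carry (t - D)))"
      using active_step(2)[OF pos IH[THEN conjunct1] IH[THEN conjunct2, THEN conjunct1]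
          IH[THEN conjunct2, THEN conjunct2, rule_format]] by (intro allI)
    then show ?thesis unfolding t by (rule exI)
  qed
  then obtain c where c: "\<forall>b. x (M + t) (Car b) = (b = c)" by (elim exE)
  then have "carry t = c" by (simp add: carry_def)
  then have "\<forall>b. x (M + t) (Car b) = (b = carry t)" using c by simp
  ultimately show ?case by (intro conjI) simp_all
qed

text \<open>
  The counter runs since time \<open>M + 1\<close>, and time is counted from \<open>M\<close> here. The marker, written at time
  \<open>M\<close>, is first read at time \<open>2 * M\<close>.
\<close>
lemma counter: "pipelined_counter q D m M digit carry"
proof
  show "digit t = 0" if "0 < t" "t < M" for t using word_zero that by (intro digit_eqI) auto
  show "digit M = q" using word_mark by (intro digit_eqI) auto
  show "\<not> carry t" if "0 < t" "t \<le> D" for t unfolding carry_def using car_zero[OF that, of True] by simp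
  show "digit (t + M) = next_digit q (digit t) (carry t)" if "0 < t" for t
    using valid[OF that] that by (intro digit_eqI next_digit_le active_step(1)) auto
  show "carry (t + D) = carry_out q (digit t) (carry t)" if "0 < t" for t
    using valid[OF that] that unfolding carry_def[of "t + D"]
    by (subst active_step(2)[of t "digit t" "carry t"]) auto
qed (use q D m M in auto)

lemma period:
  assumes "0 < \<Delta>" "\<And>t a. a \<in> set rows \<Longrightarrow> t0 \<le> t \<Longrightarrow> x (t + \<Delta>) a = x t a"
  shows "q ^ (M - 2) \<le> \<Delta>"
proof (rule pipelined_counter.long_period[OF counter assms(1)])
  fix t assume "t0 \<le> t"
  then have "word (x (M + (t + \<Delta>))) = word (x (M + t))"
    unfolding word_def using assms(2)[of "Main _" "M + t"] by (auto simp: add.assoc)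
  then show "digit (t + \<Delta>) = digit t" by (simp add: digit_def)
qed

text \<open>
  The record rows shift into each other cyclically, one row per round.
\<close>
lemma recorded:
  assumes "t < M" "j < r"
  shows "x (t + M + k * M) (Rec ((j + k) mod r)) \<longleftrightarrow> lo + j < card (word (x t))"
proof (induction k)
  case 0
  then show ?case using assms rec_step[of j t] by (simp add: fired waiting)
next
  case (Suc k)
  have prev: "(if a = 0 then r - 1 else a - 1) = (j + k) mod r" if "a = (j + Suc k) mod r" for a
    using that r by (auto simp: mod_Suc split: if_splits)
  define a where "a = (j + Suc k) mod r"
  have "x (t + M + Suc k * M) (Rec a) = x (t + M + k * M + M) (Rec a)"
    by (simp add: algebra_simps)
  also have "\<dots> = x (t + M + k * M) (Rec (if a = 0 then r - 1 else a - 1))"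
    using r by (subst rec_step) (simp_all add: a_def fired waiting)
  also have "\<dots> = x (t + M + k * M) (Rec ((j + k) mod r))"
    unfolding prev[OF a_def] ..
  finally show ?case using Suc a_def by simp
qed

end

section \<open>The trajectories of the network\<close>

text \<open>
  The states of the attractor are pairwise distinct for \<open>Q\<close> steps, as repetitions are at least \<open>Q\<close>
  apart.
\<close>
lemma long_attractor:
  assumes f: "boolean_network N f" and s: "s \<in> states N"
    and rep: "\<And>t t'. t < t' \<Longrightarrow> trajectory f s t = trajectory f s t' \<Longrightarrow> Q \<le> t' - t"
  shows "\<exists>A. attractor N f A \<and> (\<exists>t. trajectory f s t \<in> A) \<and> Q \<le> card A"
proof -
  have fin: "finite (states N)" by (auto simp: states_def intro: finite_PiE)
  have in_states: "trajectory f s' t \<in> states N" if "s' \<in> states N" for s' t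
    using that f by (induction t) (auto simp: trajectory_def boolean_network_def)
  have add: "trajectory f (trajectory f s t) k = trajectory f s (t + k)" for t k
    unfolding trajectory_def by (subst add.commute) (simp add: funpow_add)
  have range_sub: "range (trajectory f s') \<subseteq> states N" if "s' \<in> states N" for s'
    using in_states[OF that] by blast
  have "\<not> inj (trajectory f s)"
    using finite_subset[OF range_sub[OF s] fin] finite_imageD infinite_UNIV_nat by blast
  then obtain t t' where t: "t < t'" "trajectory f s t = trajectory f s t'"
    unfolding inj_def by (metis linorder_neqE_nat)
  define a where "a = trajectory f s t"
  have a: "a \<in> states N" using in_states s by (simp add: a_def)
  have "trajectory f a (t' - t) = a" unfolding a_def add using t by simp
  then have att: "attractor N f (range (trajectory f a))"
    unfolding attractor_def using a t(1) by (metis zero_less_diff)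
  have "inj_on (trajectory f a) {..<Q}"
  proof (rule linorder_inj_onI)
    fix i j assume ij: "i < j" "i \<in> {..<Q}" "j \<in> {..<Q}"
    show "trajectory f a i \<noteq> trajectory f a j"
    proof
      assume "trajectory f a i = trajectory f a j"
      then have "Q \<le> (t + j) - (t + i)" using ij unfolding a_def add by (intro rep) auto
      then show False using ij by simp
    qed
  qed auto
  then have "Q = card (trajectory f a ` {..<Q})" by (simp add: card_image)
  also have "\<dots> \<le> card (range (trajectory f a))"
    by (intro card_mono finite_subset[OF range_sub[OF a] fin]) auto
  finally have "Q \<le> card (range (trajectory f a))" .
  moreover have "a \<in> range (trajectory f a)"
    by (rule range_eqI[of _ _ 0]) (simp add: trajectory_def)
  then have "trajectory f s t \<in> range (trajectory f a)" by (simp add: a_def)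
  ultimately show ?thesis using att by (intro exI[of _ "range (trajectory f a)"] conjI exI[of _ t])
qed

lemma (in antichain_code) formulas_exist:
  "\<exists>\<phi> H. \<forall>a\<in>set rows. formula_vars (\<phi> a) \<subseteq> set rows \<and> formula_depth (\<phi> a) \<le> H \<and>
     (\<forall>x. formula_val (\<phi> a) x = logic a x)"
proof -
  have "\<exists>\<phi>. formula_vars \<phi> \<subseteq> set rows \<and> (\<forall>x. formula_val \<phi> x = logic a x)" if "a \<in> set rows" for a
    by (rule monotone_formula[OF _ logic_mono]) (simp, rule logic_cong[OF that], blast)
  then obtain \<phi> where \<phi>: "\<And>a. a \<in> set rows \<Longrightarrow> formula_vars (\<phi> a) \<subseteq> set rows \<and>
      (\<forall>x. formula_val (\<phi> a) x = logic a x)" by metis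
  have "formula_depth (\<phi> a) \<le> Max ((\<lambda>a. formula_depth (\<phi> a)) ` set rows)" if "a \<in> set rows" for a
    using that by (intro Max_ge) auto
  then show ?thesis using \<phi> by (intro exI[of _ \<phi>] exI[of _ "Max ((\<lambda>a. formula_depth (\<phi> a)) ` set rows)"]) simp
qed

fun row_timer :: "row \<Rightarrow> bool option" where
  "row_timer (Tim pol late i) = Some pol"
| "row_timer _ = None"

text \<open>
  A row of length \<open>n\<close> and the latency \<open>D\<close> make a loop of \<open>n + D\<close> steps: this gives \<open>M\<close> for digits and
  records and \<open>D\<close> for the carry. A ladder of length \<open>n\<close> fires at time \<open>n + 1\<close>.
\<close>
fun row_len :: "nat \<Rightarrow> nat \<Rightarrow> row \<Rightarrow> nat" where
  "row_len D M (Main i) = M - D"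
| "row_len D M (Rec j) = M - D"
| "row_len D M (Car b) = 0"
| "row_len D M (Tim pol late i) = (if late then M else M - 1)"

locale counter_network = antichain_code +
  fixes \<phi> :: "row \<Rightarrow> row formula" and H m M D L d N :: nat
  assumes \<phi>: "\<And>a. a \<in> set rows \<Longrightarrow> formula_vars (\<phi> a) \<subseteq> set rows \<and> formula_depth (\<phi> a) \<le> H \<and>
     (\<forall>x. formula_val (\<phi> a) x = logic a x)"
    and D: "D = 2 * H + length rows + 3"
    and m: "0 < m" and M: "M = m * D + 1" and depth: "L < 2 ^ d"
begin

sublocale machine rows "row_len D M" row_timer \<phi> H "Rec 0" L d N
  using \<phi> r depth by unfold_locales auto

lemma latency: "latency = D"
  by (simp add: latency_def D)

lemma D_pos: "0 < D" by (simp add: D)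

lemma D_less_M: "D < M"
proof -
  have "1 * D \<le> m * D" by (rule mult_le_mono1) (use m in simp)
  then show ?thesis unfolding M by linarith
qed

text \<open>
  The last summand is a crude bound for the circuit, which has constant size. The essential
  terms are \<open>(l + r + 4 * h) * M\<close> for the registers and timers and \<open>2 * L\<close> for the tree.
\<close>
lemma card_working_nodes:
  "card working_nodes \<le> (l + r + 4 * h) * M + 2 * L + d + 2 * D * 2 ^ D"
proof -
  define w where "w = Suc (M - D)"
  have M_pos: "Suc (M - 1) = M" using M by simp
  have "(\<Sum>a\<in>set rows. Suc (row_len D M a)) = (\<Sum>a\<leftarrow>rows. Suc (row_len D M a))"
    using distinct_rows by (simp add: sum_list_distinct_conv_sum_set)
  also have "\<dots> = (l + r) * w + 2 + 2 * h * M + 2 * h * Suc M"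
    unfolding rows_def map_append map_map sum_list_append comp_def list.map row_len.simps
      w_def[symmetric] sum_list_triv if_True if_False M_pos
    by (simp add: algebra_simps)
  also have "\<dots> \<le> (l + r) * M + 2 + 4 * h * M + 2 * h"
  proof -
    have "(l + r) * w \<le> (l + r) * M"
      using D_pos D_less_M by (intro mult_le_mono2) (simp add: w_def)
    then show ?thesis by simp
  qed
  finally have cells: "card cells \<le> (l + r + 4 * h) * M + 2 + 2 * h"
    using card_cells[OF distinct_rows] by (simp add: algebra_simps)
  have le: "length rows * 2 ^ Suc n \<le> (D - 3) * 2 ^ D" if "Suc n \<le> D" for n
    using that D by (intro mult_le_mono power_increasing) auto
  have "card casts \<le> (D - 3) * 2 ^ D" "card forms \<le> (D - 3) * 2 ^ D"
    using card_casts card_forms le[of "H + length rows"] le[of H] D by linarith+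
  moreover have "card working_nodes \<le> card cells + card casts + card forms + card trees"
    unfolding working_nodes_def
    by (intro order_trans[OF card_Un_le] add_mono) auto
  ultimately have "card working_nodes \<le>
      (l + r + 4 * h) * M + 2 + 2 * h + 2 * ((D - 3) * 2 ^ D) + 2 * L + Suc d"
    using cells card_trees by linarith
  also have "3 + 2 * h + 2 * ((D - 3) * 2 ^ D) \<le> 2 * D * 2 ^ D"
  proof -
    have "D < 2 ^ D" by (rule less_exp)
    have "3 + 2 * h \<le> 6 * 2 ^ D" using \<open>D < 2 ^ D\<close> D length_rows by linarith
    moreover have "2 * (a + 3) * z = 6 * z + 2 * (a * z)" for a z :: nat
      by (simp add: algebra_simps)
    then have "2 * (D - 3 + 3) * 2 ^ D = 6 * 2 ^ D + 2 * ((D - 3) * 2 ^ D)" .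
    then have "2 * D * 2 ^ D = 6 * 2 ^ D + 2 * ((D - 3) * 2 ^ D)"
      using D by simp
    ultimately show ?thesis by simp
  qed
  then have "(l + r + 4 * h) * M + 2 + 2 * h + 2 * ((D - 3) * 2 ^ D) + 2 * L + Suc d \<le>
      (l + r + 4 * h) * M + 2 * L + d + 2 * D * 2 ^ D" by linarith
  finally show ?thesis .
qed

text \<open>
  At each time before a group of \<open>h\<close> parallel ladders is due to fire, one of them is held back by an
  initial value. The lengths of the rows in a group agree, which is why index 0 can stand for all.
\<close>
definition timers_good :: "(row node \<Rightarrow> bool) \<Rightarrow> bool" where
  "timers_good s \<longleftrightarrow> (\<forall>pol late t. t \<le> row_len D M (Tim pol late 0) \<longrightarrow>
     (\<exists>i<h. \<exists>j. row_len D M (Tim pol late 0) - 2 * t \<le> j \<and> j \<le> row_len D M (Tim pol late 0) - t \<and>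
        s (Cell (Tim pol late i) j) \<noteq> pol))"

context
  fixes S assumes run: "is_run S" and good: "timers_good (S 0)"
begin

lemma timer_value:
  "t \<le> row_len D M (Tim pol late 0) \<Longrightarrow> \<exists>i<h. row_end S t (Tim pol late i) \<noteq> pol"
  "row_len D M (Tim pol late 0) < t \<Longrightarrow> i < h \<Longrightarrow> row_end S t (Tim pol late i) = pol"
proof -
  define n where "n = row_len D M (Tim pol late 0)"
  have lad: "row_end S t (Tim pol late i) = pol \<longleftrightarrow>
      n < t \<or> (\<forall>j. n - 2 * t \<le> j \<and> j \<le> n - t \<longrightarrow> S 0 (Cell (Tim pol late i) j) = pol)" if "i < h" for i
    using ladder_val[OF run, of "Tim pol late i" pol n t] that by (simp add: row_end_def n_def)
  show "\<exists>i<h. row_end S t (Tim pol late i) \<noteq> pol" if "t \<le> row_len D M (Tim pol late 0)"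
  proof -
    have "t \<le> n" using that by (simp only: n_def)
    moreover have "\<exists>i<h. \<exists>j. n - 2 * t \<le> j \<and> j \<le> n - t \<and> S 0 (Cell (Tim pol late i) j) \<noteq> pol"
      using good that unfolding timers_good_def n_def by (elim allE impE)
    then obtain i j where "i < h" "n - 2 * t \<le> j" "j \<le> n - t" "S 0 (Cell (Tim pol late i) j) \<noteq> pol"
      by (elim exE conjE)
    ultimately have "row_end S t (Tim pol late i) \<noteq> pol" unfolding lad[OF \<open>i < h\<close>] by auto
    then show ?thesis using \<open>i < h\<close> by (intro exI conjI)
  qed
  show "row_end S t (Tim pol late i) = pol" if "row_len D M (Tim pol late 0) < t" "i < h"
    unfolding lad[OF that(2)] n_def using that(1) by (rule disjI1)
qed

lemma counter_run: "counter_run l r h q lo code D m M (row_end S)"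
proof
  have "M = (M - D) + D" using D_less_M by simp
  then have step: "row_end S (t + M) a = logic a (row_end S t)"
    if "a \<in> set rows" "row_timer a = None" "row_len D M a = M - D" for t a
    using row_end_step[OF run that(1,2), of t] \<phi>[OF that(1)] that(3) D_less_M by (simp add: latency)
  show "row_end S (t + M) (Main i) = logic (Main i) (row_end S t)" if "i < l" for t i
    using step that by simp
  show "row_end S (t + M) (Rec i) = logic (Rec i) (row_end S t)" if "i < r" for t i
    using step that by simp
  show "row_end S (t + D) (Car b) = logic (Car b) (row_end S t)" for t b
    using row_end_step[OF run, of "Car b" t] \<phi>[of "Car b"] by (simp add: latency)
  have len: "row_len D M (Tim pol late 0) < t \<longleftrightarrow> (if late then M < t else M \<le> t)" for pol late t
    using D_less_M by auto
  show fired: "fired late (row_end S t) \<longleftrightarrow> (if late then M < t else M \<le> t)" for t late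
  proof (cases "row_len D M (Tim True late 0) < t")
    case True
    then show ?thesis unfolding fired_def using timer_value(2)[OF True] len[of True late t] by (cases late) auto
  next
    case False
    then show ?thesis unfolding fired_def using timer_value(1)[of t True late] len[of True late t]
      by (simp only: not_less) auto
  qed
  show "waiting late (row_end S t) \<longleftrightarrow> \<not> fired late (row_end S t)" for t late
  proof (cases "row_len D M (Tim False late 0) < t")
    case True
    then show ?thesis unfolding fired waiting_def using timer_value(2)[OF True] len[of False late t] by (cases late) auto
  next
    case False
    then show ?thesis unfolding fired waiting_def using timer_value(1)[of t False late] len[of False late t]
      by (simp only: not_less) auto
  qed
qed (use D_pos m M in auto)

end

text \<open>
  The state determines the future, so a repetition makes all signals periodic from then on.
\<close>
lemma spaced:
  assumes run: "is_run S" and good: "timers_good (S 0)"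
    and eq: "t < t'" "\<And>v. v \<in> nodes \<Longrightarrow> S t v = S t' v"
  shows "q ^ (M - 2) \<le> t' - t"
proof -
  interpret counter_run l r h q lo code D m M "row_end S" by (rule counter_run[OF run good])
  have shift: "S (t + n) v = S (t' + n) v" if "v \<in> nodes" for n v
    using that
  proof (induction n arbitrary: v)
    case (Suc n)
    then have "gate_val (gate v) (S (t + n)) = gate_val (gate v) (S (t' + n))"
      using inputs_in_nodes by (intro gate_val_cong) blast
    then show ?case using step[OF run] Suc.prems by simp
  qed (use eq in simp)
  show ?thesis
  proof (rule period)
    show "0 < t' - t" using eq by simp
    show "row_end S (u + (t' - t)) a = row_end S u a" if "a \<in> set rows" "t \<le> u" for u a
    proof -
      have "u + (t' - t) = t' + (u - t)" "u = t + (u - t)" using that eq by auto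
      then show ?thesis using shift[of "Cell a (row_len D M a)" "u - t"] that by (simp add: row_end_def)
    qed
  qed
qed

text \<open>
  Flipping the bit moves the number of ones in its word across the threshold given by the number of
  ones among the other bits. The two records of this comparison differ for ever, and whenever they
  pass \<open>Rec 0\<close> the difference appears at all leaves of the tree \<open>d + 1\<close> steps later.
\<close>
lemma spreading:
  assumes run: "is_run S" "is_run S'" and good: "timers_good (S 0)"
    and b: "b < l" "k \<le> M - D"
    and flip: "\<And>v. v \<in> nodes \<Longrightarrow> S' 0 v = (if v = Cell (Main b) k then \<not> S 0 v else S 0 v)"
    and mid: "lo \<le> card {i. i < l \<and> i \<noteq> b \<and> S 0 (Cell (Main i) k)}"
      "card {i. i < l \<and> i \<noteq> b \<and> S 0 (Cell (Main i) k)} < lo + r"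
  shows "infinite {t. 0 < t \<and> (\<forall>i\<le>L. S t (Tree d i) \<noteq> S' t (Tree d i))}"
proof -
  have good': "timers_good (S' 0)"
  proof -
    have "S' 0 (Cell (Tim pol late i) j) = S 0 (Cell (Tim pol late i) j)"
      if "i < h" "j \<le> row_len D M (Tim pol late 0) - t" for pol late i j t
    proof -
      have "j \<le> row_len D M (Tim pol late i)" using that(2) by simp
      then show ?thesis using flip[of "Cell (Tim pol late i) j"] that(1) by simp
    qed
    then show ?thesis using good unfolding timers_good_def by metis
  qed
  interpret R: counter_run l r h q lo code D m M "row_end S" by (rule counter_run[OF run(1) good])
  interpret R': counter_run l r h q lo code D m M "row_end S'" by (rule counter_run[OF run(2) good'])
  define t where "t = M - D - k"
  have tM: "t < M" using D_less_M D_pos by (simp add: t_def)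
  have k: "M - D - t = k" using b by (simp add: t_def)
  define U where "U = {i. i < l \<and> i \<noteq> b \<and> S 0 (Cell (Main i) k)}"
  have init: "row_end T t (Main i) = T 0 (Cell (Main i) k)" if "is_run T" "i < l" for T i
    using row_end_initial[OF that(1), of "Main i" t] that(2) k by (simp add: t_def)
  have word: "word (row_end S t) = (if S 0 (Cell (Main b) k) then insert b U else U)"
    "word (row_end S' t) = (if S 0 (Cell (Main b) k) then U else insert b U)"
  proof -
    have "S' 0 (Cell (Main i) k) = (if i = b then \<not> S 0 (Cell (Main b) k) else S 0 (Cell (Main i) k))"
      if "i < l" for i using flip[of "Cell (Main i) k"] that b by simp
    then show "word (row_end S t) = (if S 0 (Cell (Main b) k) then insert b U else U)"
      "word (row_end S' t) = (if S 0 (Cell (Main b) k) then U else insert b U)"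
      using b init[OF run(1)] init[OF run(2)]
      by (auto simp: word_def U_def split: if_splits)
  qed
  have U: "finite U" "b \<notin> U" by (auto simp: U_def)
  define j where "j = card U - lo"
  have j: "j < r" "lo + j = card U" using mid by (auto simp: j_def U_def)
  have differ: "(lo + j < card (word (row_end S t))) \<noteq> (lo + j < card (word (row_end S' t)))"
    unfolding word j(2) using U by simp
  \<comment> \<open>After \<open>r - j\<close> rounds the record has moved from row \<open>j\<close> to row 0, and then it returns every \<open>r\<close> rounds.\<close>
  define time where "time n = Suc (t + M + (r - j + n * r) * M + d)" for n
  have "\<forall>i\<le>L. S (time n) (Tree d i) \<noteq> S' (time n) (Tree d i)" for n
  proof (intro allI impI)
    fix i assume i: "i \<le> L"
    have "j + (r - j + n * r) = r + n * r" using j by simp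
    then have mod: "(j + (r - j + n * r)) mod r = 0" by simp
    have "row_end S (t + M + (r - j + n * r) * M) (Rec 0) \<noteq> row_end S' (t + M + (r - j + n * r) * M) (Rec 0)"
      using R.recorded[OF tM j(1), of "r - j + n * r"] R'.recorded[OF tM j(1), of "r - j + n * r"] differ
      unfolding mod by simp
    then show "S (time n) (Tree d i) \<noteq> S' (time n) (Tree d i)"
      unfolding time_def using i tree_val[OF run(1), of d i] tree_val[OF run(2), of d i] by simp
  qed
  then have "range time \<subseteq> {t. 0 < t \<and> (\<forall>i\<le>L. S t (Tree d i) \<noteq> S' t (Tree d i))}"
    by (auto simp: time_def)
  moreover have "inj time"
    using r D_less_M by (auto simp: inj_def time_def)
  then have "infinite (range time)" by (simp add: finite_image_iff)
  ultimately show ?thesis using infinite_super by blast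
qed

lemma network_exists:
  assumes "(l + r + 4 * h) * M + 2 * L + d + 2 * D * 2 ^ D \<le> N"
  obtains f e where "bij_betw e nodes {1..N}"
    and "boolean_network N f" "cooperative N f" "bi_quadratic N f"
    and "\<And>s. is_run (\<lambda>t v. trajectory f s t (e v))"
proof -
  have "card nodes = N" using card_working_nodes assms by (intro card_nodes) linarith
  with gates_to_network[OF finite_nodes this inputs_in_nodes fanout]
  obtain f e where "bij_betw e nodes {1..N}"
    and "boolean_network N f" "cooperative N f" "bi_quadratic N f"
    and "\<And>s v. v \<in> nodes \<Longrightarrow> f s (e v) = gate_val (gate v) (\<lambda>u. s (e u))" by metis
  then show ?thesis using that by (force simp: is_run_def trajectory_def)
qed

end

section \<open>Random states and random flips\<close>

lemma random_state_coins: "random_state N = Pi_pmf {1..N} undefined (\<lambda>_. bernoulli_pmf (1/2))"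
proof -
  have "PiE_dflt {1..N} undefined (\<lambda>_. UNIV :: bool set) = states N"
    by (auto simp: PiE_dflt_def states_def PiE_def extensional_def)
  then show ?thesis
    by (simp add: random_state_def bernoulli_pmf_half_conv_pmf_of_set Pi_pmf_of_set)
qed

lemma prob_bits:
  assumes e: "inj_on e V" "e ` V \<subseteq> {1..N}" and C: "C \<subseteq> V"
  shows "measure_pmf.prob (random_state N) {s. \<forall>v\<in>C. s (e v) = g} = (1/2) ^ card C"
proof -
  define S where "S = e ` C"
  have S: "S \<subseteq> {1..N}" using C e by (auto simp: S_def)
  have "{s. \<forall>v\<in>C. s (e v) = g} = Pi {1..N} (\<lambda>i. if i \<in> S then {g} else UNIV)"
    using S by (auto simp: S_def Pi_def split: if_splits)
  then have "measure_pmf.prob (random_state N) {s. \<forall>v\<in>C. s (e v) = g} =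
      (\<Prod>i\<in>{1..N}. measure_pmf.prob (bernoulli_pmf (1/2)) (if i \<in> S then {g} else UNIV))"
    unfolding random_state_coins by (simp add: measure_Pi_pmf_Pi)
  also have "\<dots> = (\<Prod>i\<in>{1..N}. if i \<in> S then 1/2 else 1)"
    by (intro prod.cong) (auto simp: measure_pmf_single)
  also have "\<dots> = (1/2) ^ card S"
    using S by (subst prod.inter_restrict[symmetric]) (auto simp: Int_absorb1)
  also have "card S = card C"
    unfolding S_def using e C by (intro card_image) (auto intro: inj_on_subset)
  finally show ?thesis .
qed

lemma prob_weight:
  assumes e: "inj_on e V" "e ` V \<subseteq> {1..N}" and C: "C \<subseteq> V" "0 < card C" and "0 \<le> \<epsilon>"
  shows "measure_pmf.prob (random_state N)
      {s. \<epsilon> \<le> \<bar>real (card {v\<in>C. s (e v)}) - real (card C) / 2\<bar>} \<le> 2 * exp (- 2 * \<epsilon>\<^sup>2 / real (card C))"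
proof -
  define S where "S = e ` C"
  have S: "S \<subseteq> {1..N}" "finite S" using C e by (auto simp: S_def intro: finite_subset)
  have inj: "inj_on e C" using e C by (auto intro: inj_on_subset)
  have card: "card S = card C" unfolding S_def using inj by (intro card_image)
  have count: "card {v\<in>C. s (e v)} = card {i\<in>S. s i}" for s
  proof -
    have "{i\<in>S. s i} = e ` {v\<in>C. s (e v)}" by (auto simp: S_def)
    moreover have "inj_on e {v\<in>C. s (e v)}" using inj by (rule inj_on_subset) auto
    ultimately show ?thesis by (simp add: card_image)
  qed
  have "binomial_pmf (card C) (1/2) =
      map_pmf (\<lambda>f. card {i\<in>S. f i}) (Pi_pmf S undefined (\<lambda>_. bernoulli_pmf (1/2)))"
    using S card by (intro binomial_pmf_altdef') auto
  also have "\<dots> = map_pmf (\<lambda>f. card {i\<in>S. f i}) (random_state N)"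
    unfolding random_state_coins using S
    by (subst Pi_pmf_subset[of "{1..N}" S]) (auto simp: map_pmf_comp intro!: map_pmf_cong arg_cong[of _ _ card])
  finally have "measure_pmf.prob (random_state N) {s. \<epsilon> \<le> \<bar>real (card {v\<in>C. s (e v)}) - real (card C) / 2\<bar>} =
      measure_pmf.prob (binomial_pmf (card C) (1/2)) {k. \<epsilon> \<le> \<bar>real k - real (card C) * (1/2)\<bar>}"
    by (simp add: count vimage_def)
  also have "\<dots> \<le> 2 * exp (- 2 * \<epsilon>\<^sup>2 / real (card C))"
    using assms by (intro binomial_distribution.prob_abs_ge) (auto simp: binomial_distribution_def)
  finally show ?thesis .
qed

lemma prob_pair_uniform_ge:
  assumes I: "finite I" "G \<subseteq> I" "I \<noteq> {}"
    and ge: "\<And>i. i \<in> G \<Longrightarrow> \<delta> \<le> measure_pmf.prob A {s. Q s i}" and \<delta>: "0 \<le> \<delta>"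
  shows "real (card G) / real (card I) * \<delta> \<le> measure_pmf.prob (pair_pmf A (pmf_of_set I)) {(s, i). Q s i}"
proof -
  have "emeasure (pair_pmf A (pmf_of_set I)) {(s, i). Q s i} =
      (\<integral>\<^sup>+i. emeasure A {s. Q s i} \<partial>pmf_of_set I)"
    unfolding pair_pmf_def bind_commute_pmf[of A]
    by (subst emeasure_bind_pmf, intro nn_integral_cong)
      (simp add: emeasure_map_pmf vimage_def flip: map_pmf_def)
  also have "\<dots> = (\<Sum>i\<in>I. emeasure A {s. Q s i} * (1 / real (card I)))"
    using I by (subst nn_integral_measure_pmf_finite) (auto intro!: sum.cong)
  also have "\<dots> = (\<Sum>i\<in>I. ennreal (measure_pmf.prob A {s. Q s i} * (1 / real (card I))))"
    by (intro sum.cong refl) (simp add: measure_pmf.emeasure_eq_measure flip: ennreal_mult)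
  also have "\<dots> = ennreal (\<Sum>i\<in>I. measure_pmf.prob A {s. Q s i} * (1 / real (card I)))"
    by (rule sum_ennreal) simp
  finally have "measure_pmf.prob (pair_pmf A (pmf_of_set I)) {(s, i). Q s i} =
      (\<Sum>i\<in>I. measure_pmf.prob A {s. Q s i} * (1 / real (card I)))"
    by (simp add: measure_def sum_nonneg)
  moreover have "(\<Sum>i\<in>G. \<delta> * (1 / real (card I))) \<le> (\<Sum>i\<in>G. measure_pmf.prob A {s. Q s i} * (1 / real (card I)))"
    using ge by (intro sum_mono mult_right_mono) auto
  moreover have "\<dots> \<le> (\<Sum>i\<in>I. measure_pmf.prob A {s. Q s i} * (1 / real (card I)))"
    using I by (intro sum_mono2) auto
  ultimately show ?thesis by simp
qed

lemma geometric_bound: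
  fixes z :: real
  assumes "0 \<le> z" "z \<le> 1/2"
  shows "(\<Sum>t\<le>n. z ^ (min t (n - t) + 1)) \<le> 4 * z"
proof -
  have geo: "(\<Sum>t\<le>n. z ^ (t + 1)) \<le> 2 * z"
  proof -
    have "(\<Sum>t\<le>n. z ^ (t + 1)) = z * (\<Sum>t<Suc n. z ^ t)"
      by (simp add: sum_distrib_left lessThan_Suc_atMost)
    also have "\<dots> \<le> z * 2"
    proof (rule mult_left_mono[OF _ assms(1)])
      have "(\<Sum>t<Suc n. z ^ t) \<le> 1 / (1 - z)"
        using assms by (subst sum_gp_strict) (auto intro!: divide_right_mono)
      also have "\<dots> \<le> 2" using assms by (simp add: field_simps)
      finally show "(\<Sum>t<Suc n. z ^ t) \<le> 2" .
    qed
    finally show ?thesis by (simp only: mult.commute)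
  qed
  have "(\<Sum>t\<le>n. z ^ (min t (n - t) + 1)) \<le> (\<Sum>t\<le>n. z ^ (t + 1) + z ^ (n - t + 1))"
    using assms by (intro sum_mono) (auto simp: min_def)
  also have "\<dots> = (\<Sum>t\<le>n. z ^ (t + 1)) + (\<Sum>t\<le>n. z ^ (n - t + 1))"
    by (rule sum.distrib)
  also have "(\<Sum>t\<le>n. z ^ (n - t + 1)) = (\<Sum>t\<le>n. z ^ (t + 1))"
    using sum.nat_diff_reindex[of "\<lambda>t. z ^ (t + 1)" "Suc n"] by (simp add: lessThan_Suc_atMost)
  finally show ?thesis using geo by simp
qed

context counter_network
begin

text \<open>
  A ladder of length \<open>n\<close> fires too early, at time \<open>t\<close>, only if \<open>min t (n - t) + 1\<close> of its random
  initial values agree, and for this to happen in all \<open>h\<close> ladders of a group the exponent is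
  multiplied by \<open>h\<close>. The sum over all \<open>t\<close> is geometric from both ends, so it does not grow with the length \<open>n\<close>. The factor
  16 comes from four groups and the factor 4 in the bound of such sums.
\<close>
lemma prob_timers:
  assumes e: "inj_on e nodes" "e ` nodes \<subseteq> {1..N}" and h: "0 < h"
  shows "measure_pmf.prob (random_state N) {s. \<not> timers_good (\<lambda>v. s (e v))} \<le> 16 * (1/2) ^ h"
proof -
  define n where "n pol late = row_len D M (Tim pol late 0)" for pol late
  \<comment> \<open>The initial cells that decide the values at time \<open>t\<close> of the ladders in one group.\<close>
  define C where "C pol late t = (\<lambda>(i, j). Cell (Tim pol late i) j) `
      ({..<h} \<times> {n pol late - 2 * t..n pol late - t})" for pol late t
  define B where "B pol late t = {s :: nat \<Rightarrow> bool. \<forall>v\<in>C pol late t. s (e v) = pol}" for pol late t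
  have cardC: "card (C pol late t) = h * (min t (n pol late - t) + 1)" if "t \<le> n pol late" for pol late t
  proof -
    have "card (C pol late t) = h * (Suc (n pol late - t) - (n pol late - 2 * t))"
      unfolding C_def by (subst card_image) (auto simp: inj_on_def)
    also have "Suc (n pol late - t) - (n pol late - 2 * t) = min t (n pol late - t) + 1"
      using that by auto
    finally show ?thesis .
  qed
  have C_sub: "C pol late t \<subseteq> nodes" for pol late t
    by (auto simp: C_def n_def)
  have PB: "measure_pmf.prob (random_state N) (B pol late t) = ((1/2) ^ h) ^ (min t (n pol late - t) + 1)"
    if "t \<le> n pol late" for pol late t
    unfolding B_def prob_bits[OF e C_sub] cardC[OF that] by (rule power_mult)
  have row: "measure_pmf.prob (random_state N) (\<Union>t\<in>{..n pol late}. B pol late t) \<le> 4 * (1/2) ^ h" for pol late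
  proof -
    have "measure_pmf.prob (random_state N) (\<Union>t\<in>{..n pol late}. B pol late t) \<le>
        (\<Sum>t\<in>{..n pol late}. measure_pmf.prob (random_state N) (B pol late t))"
      by (intro measure_pmf.finite_measure_subadditive_finite) auto
    also have "\<dots> = (\<Sum>t\<le>n pol late. ((1/2) ^ h) ^ (min t (n pol late - t) + 1))"
      by (intro sum.cong) (auto simp: PB)
    also have "\<dots> \<le> 4 * (1/2) ^ h"
      using power_decreasing[of 1 h "1/2 :: real"] h by (intro geometric_bound) auto
    finally show ?thesis .
  qed
  have "{s. \<not> timers_good (\<lambda>v. s (e v))} \<subseteq> (\<Union>a\<in>UNIV. \<Union>t\<in>{..n (fst a) (snd a)}. B (fst a) (snd a) t)"
  proof
    fix s assume "s \<in> {s. \<not> timers_good (\<lambda>v. s (e v))}"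
    then obtain pol late t where "t \<le> n pol late"
      "\<forall>i<h. \<forall>j. n pol late - 2 * t \<le> j \<and> j \<le> n pol late - t \<longrightarrow> s (e (Cell (Tim pol late i) j)) = pol"
      unfolding timers_good_def n_def mem_Collect_eq by meson
    then have "s \<in> B pol late t" by (auto simp: B_def C_def)
    then show "s \<in> (\<Union>a\<in>UNIV. \<Union>t\<in>{..n (fst a) (snd a)}. B (fst a) (snd a) t)"
      using \<open>t \<le> n pol late\<close> by (intro UN_I[of "(pol, late)"] UN_I[of t]) auto
  qed
  then have "measure_pmf.prob (random_state N) {s. \<not> timers_good (\<lambda>v. s (e v))} \<le>
      measure_pmf.prob (random_state N) (\<Union>a\<in>UNIV. \<Union>t\<in>{..n (fst a) (snd a)}. B (fst a) (snd a) t)"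
    by (intro measure_pmf.finite_measure_mono) auto
  also have "\<dots> \<le> (\<Sum>a\<in>UNIV. measure_pmf.prob (random_state N) (\<Union>t\<in>{..n (fst a) (snd a)}. B (fst a) (snd a) t))"
    by (intro measure_pmf.finite_measure_subadditive_finite) auto
  also have "\<dots> \<le> (\<Sum>a\<in>(UNIV :: (bool \<times> bool) set). 4 * (1/2) ^ h)"
    by (intro sum_mono row)
  also have "\<dots> = 16 * (1/2) ^ h"
    by (simp add: UNIV_Times_UNIV[symmetric] card_cartesian_product del: UNIV_Times_UNIV)
  finally show ?thesis .
qed

text \<open>
  If the timers work, the trajectory runs the counter, whatever the other bits are. For decoherence,
  the flip should also hit a cell of a digit row, and the other \<open>l - 1\<close> bits of the same word should
  have a number of ones within the range of the thresholds, which holds by Hoeffding's inequality up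
  to the exponential term.
\<close>
theorem chaotic_decoherent_network:
  fixes p c \<alpha> \<rho> :: real
  assumes size: "(l + r + 4 * h) * M + 2 * L + d + 2 * D * 2 ^ D \<le> N" and N: "0 < N"
    and h: "0 < h" and l: "2 \<le> l"
    and chaos: "p < 1 - 16 * (1/2) ^ h" "c ^ N < real (q ^ (M - 2))"
    and L: "\<alpha> * N \<le> real L + 1"
    and \<rho>: "0 \<le> \<rho>" "lo \<le> (l - 1) / 2 - \<rho>" "(l - 1) / 2 + \<rho> \<le> lo + r"
    and deco: "p \<le> l * real (M - D) / N * (1 - 16 * (1/2) ^ h - 2 * exp (- 2 * \<rho>\<^sup>2 / (l - 1)))"
    and pos: "0 \<le> 1 - 16 * (1/2) ^ h - 2 * exp (- 2 * \<rho>\<^sup>2 / (l - 1))"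
  shows "\<exists>f. boolean_network N f \<and> cooperative N f \<and> bi_quadratic N f \<and>
           chaotic p c N f \<and> decoherent p \<alpha> N f"
proof -
  obtain f e where e: "bij_betw e nodes {1..N}"
    and net: "boolean_network N f" "cooperative N f" "bi_quadratic N f"
    and run: "\<And>s. is_run (\<lambda>t v. trajectory f s t (e v))"
    by (rule network_exists[OF size], rule that)
  have inj: "inj_on e nodes" and im: "e ` nodes \<subseteq> {1..N}" using e by (auto simp: bij_betw_def)
  let ?P = "measure_pmf.prob (random_state N)"
  let ?good = "\<lambda>s. timers_good (\<lambda>v. s (e v))"
  have init: "trajectory f s 0 = s" for s by (simp add: trajectory_def)
  have P_states: "?P X = ?P (X \<inter> states N)" for X
  proof -
    have "finite (states N)" "states N \<noteq> {}" by (auto simp: states_def PiE_eq_empty_iff intro: finite_PiE)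
    then have "set_pmf (random_state N) = states N" by (simp add: random_state_def)
    then show ?thesis using measure_Int_set_pmf by metis
  qed
  have P_good: "1 - 16 * (1/2) ^ h \<le> ?P {s. ?good s}"
  proof -
    have "?P {s. \<not> ?good s} = 1 - ?P {s. ?good s}"
      using measure_pmf.prob_compl[of "{s. ?good s}" "random_state N"] by (simp add: set_diff_eq)
    then show ?thesis using prob_timers[OF inj im h] by simp
  qed
  have "chaotic p c N f"
  proof -
    have "\<exists>A. attractor N f A \<and> (\<exists>t. trajectory f s t \<in> A) \<and> c ^ N < real (card A)"
      if s: "s \<in> states N" "?good s" for s
    proof -
      have "q ^ (M - 2) \<le> t' - t" if "t < t'" "trajectory f s t = trajectory f s t'" for t t'
        using spaced[OF run[of s], of t t'] s that by (simp add: init)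
      from long_attractor[OF net(1) s(1) this]
      obtain A where "attractor N f A" "\<exists>t. trajectory f s t \<in> A" "q ^ (M - 2) \<le> card A" by blast
      moreover from this(3) have "real (q ^ (M - 2)) \<le> real (card A)" by (simp only: of_nat_le_iff)
      then have "c ^ N < real (card A)" using chaos(2) by (rule order_less_le_trans[rotated])
      ultimately show ?thesis by (intro exI[of _ A] conjI)
    qed
    then have "{s. ?good s} \<inter> states N \<subseteq>
        {s. \<exists>A. attractor N f A \<and> (\<exists>t. trajectory f s t \<in> A) \<and> c ^ N < real (card A)}" by blast
    then have "?P ({s. ?good s} \<inter> states N) \<le>
        ?P {s. \<exists>A. attractor N f A \<and> (\<exists>t. trajectory f s t \<in> A) \<and> c ^ N < real (card A)}"
      by (intro measure_pmf.finite_measure_mono) auto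
    then show ?thesis unfolding chaotic_def using P_good P_states[of "{s. ?good s}"] chaos(1) by linarith
  qed
  moreover have "decoherent p \<alpha> N f"
  proof -
    define Q where "Q s i \<longleftrightarrow> infinite {t. t > 0 \<and>
          real (hamming N (trajectory f s t) (trajectory f (flip_bit i s) t)) \<ge> \<alpha> * real N}" for s i
    define G where "G = (\<lambda>(b, k). e (Cell (Main b) k)) ` ({..<l} \<times> {..M - D})"
    define \<delta> where "\<delta> = 1 - 16 * (1/2) ^ h - 2 * exp (- 2 * \<rho>\<^sup>2 / (l - 1))"
    have mem: "Cell (Main b) k \<in> nodes" if "b < l" "k \<le> M - D" for b k
      using that by simp
    have "inj_on (\<lambda>(b, k). e (Cell (Main b) k)) ({..<l} \<times> {..M - D})"
      using inj_onD[OF inj] mem by (fastforce simp: inj_on_def)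
    then have "card G = l * Suc (M - D)" by (simp add: G_def card_image)
    have G: "G \<subseteq> {1..N}" using mem im by (auto simp: G_def)
    have "\<delta> \<le> ?P {s. Q s i}" if i: "i \<in> G" for i
    proof -
      obtain b k where bk: "b < l" "k \<le> M - D" "i = e (Cell (Main b) k)"
        using i by (auto simp: G_def)
      define C where "C = (\<lambda>i. Cell (Main i) k) ` ({..<l} - {b})"
      have C_sub: "C \<subseteq> nodes" using mem bk by (auto simp: C_def)
      have cardC: "card C = l - 1" unfolding C_def using bk
        by (subst card_image) (auto simp: inj_on_def)
      define bad where "bad = {s. \<rho> \<le> \<bar>real (card {v\<in>C. s (e v)}) - real (card C) / 2\<bar>}"
      have P_bad: "?P bad \<le> 2 * exp (- 2 * \<rho>\<^sup>2 / (l - 1))"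
        using prob_weight[OF inj im C_sub _ \<rho>(1)] l cardC by (simp add: bad_def of_nat_diff)
      have "Q s i" if s: "s \<in> states N" "?good s" "s \<notin> bad" for s
      proof -
        have "{v\<in>C. s (e v)} = (\<lambda>i. Cell (Main i) k) ` {i. i < l \<and> i \<noteq> b \<and> s (e (Cell (Main i) k))}"
          by (auto simp: C_def)
        then have count: "card {v\<in>C. s (e v)} = card {i. i < l \<and> i \<noteq> b \<and> s (e (Cell (Main i) k))}"
          by (simp add: card_image inj_on_def)
        have "\<bar>real (card {i. i < l \<and> i \<noteq> b \<and> s (e (Cell (Main i) k))}) - real (l - 1) / 2\<bar> < \<rho>"
          using s(3) unfolding bad_def mem_Collect_eq count cardC by (simp only: not_le)
        then have "real lo < real (card {i. i < l \<and> i \<noteq> b \<and> s (e (Cell (Main i) k))})"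
          "real (card {i. i < l \<and> i \<noteq> b \<and> s (e (Cell (Main i) k))}) < real (lo + r)"
          using \<rho> by linarith+
        then have mid: "lo \<le> card {i. i < l \<and> i \<noteq> b \<and> s (e (Cell (Main i) k))}"
          "card {i. i < l \<and> i \<noteq> b \<and> s (e (Cell (Main i) k))} < lo + r" by linarith+
        have flip: "flip_bit i s (e v) = (if v = Cell (Main b) k then \<not> s (e v) else s (e v))" if "v \<in> nodes" for v
          using inj_onD[OF inj, of v "Cell (Main b) k"] that mem[OF bk(1,2)] by (auto simp: flip_bit_def bk(3))
        have inf: "infinite {t. 0 < t \<and> (\<forall>i'\<le>L. trajectory f s t (e (Tree d i')) \<noteq>
            trajectory f (flip_bit i s) t (e (Tree d i')))}"
          using spreading[OF run[of s] run[of "flip_bit i s"] _ bk(1,2)] flip mid s(2) by (simp add: init)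
        have "\<alpha> * real N \<le> real (hamming N (trajectory f s t) (trajectory f (flip_bit i s) t))"
          if "\<forall>i'\<le>L. trajectory f s t (e (Tree d i')) \<noteq> trajectory f (flip_bit i s) t (e (Tree d i'))" for t
        proof -
          have tree: "Tree d i' \<in> nodes" if "i' \<le> L" for i' using that by simp
          have "inj_on (\<lambda>i'. e (Tree d i')) {..L}"
            using inj_onD[OF inj] tree by (fastforce simp: inj_on_def)
          then have "Suc L = card ((\<lambda>i'. e (Tree d i')) ` {..L})" by (simp add: card_image)
          also have "\<dots> \<le> hamming N (trajectory f s t) (trajectory f (flip_bit i s) t)"
          proof -
            have "e (Tree d i') \<in> {1..N}" if "i' \<le> L" for i' using tree[OF that] im by blast
            then show ?thesis unfolding hamming_def using that by (intro card_mono) auto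
          qed
          finally show ?thesis using L by linarith
        qed
        then show ?thesis unfolding Q_def
          by (intro infinite_super[OF _ inf]) auto
      qed
      then have "{s. ?good s} \<inter> states N \<subseteq> {s. Q s i} \<union> bad" by blast
      then have "?P ({s. ?good s} \<inter> states N) \<le> ?P ({s. Q s i} \<union> bad)"
        by (intro measure_pmf.finite_measure_mono) auto
      also have "\<dots> \<le> ?P {s. Q s i} + ?P bad"
        by (rule measure_Un_le) auto
      finally show ?thesis using P_good P_states[of "{s. ?good s}"] P_bad by (simp add: \<delta>_def)
    qed
    then have "real (card G) / real (card {1..N}) * \<delta> \<le>
        measure_pmf.prob (pair_pmf (random_state N) (pmf_of_set {1..N})) {(s, i). Q s i}"
      using G N pos by (intro prob_pair_uniform_ge) (auto simp: \<delta>_def)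
    moreover have "p \<le> real (card G) / real (card {1..N}) * \<delta>"
    proof -
      have "l * real (M - D) / N * \<delta> \<le> real (card G) / real (card {1..N}) * \<delta>"
      proof (intro mult_right_mono)
        have "real l * real (M - D) \<le> real (card G)" by (simp add: \<open>card G = l * Suc (M - D)\<close>)
        then show "l * real (M - D) / N \<le> real (card G) / real (card {1..N})"
          by (simp add: divide_right_mono)
      qed (use pos in \<open>simp add: \<delta>_def\<close>)
      then show ?thesis using deco by (simp add: \<delta>_def)
    qed
    ultimately show ?thesis by (simp add: decoherent_def Q_def)
  qed
  ultimately show ?thesis using net by blast
qed

end

section \<open>Choice of the parameters\<close>

text \<open>
  Sets of the same size form an antichain. One of the middle sets serves as the marker, whence the
  subtraction of 1; the bound by the central binomial coefficient leaves room for it.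
\<close>
lemma middle_layer_code:
  assumes k: "2 \<le> k" and r: "0 < r"
  defines "q \<equiv> (2 * k choose k) - 1"
  obtains layer where "antichain_code (2 * k) r q layer"
    and "4 ^ k / (4 * real k) \<le> real q"
proof -
  define X where "X = {S. S \<subseteq> {..<2 * k} \<and> card S = k}"
  have fin: "finite X" by (auto simp: X_def)
  have "card X = 2 * k choose k" unfolding X_def using n_subsets[of "{..<2 * k}" k] by simp
  moreover have lower: "4 ^ k / (2 * real k) \<le> real (2 * k choose k)"
    using central_binomial_lower_bound[of k] k by simp
  have big: "4 * real k \<le> 4 ^ k"
  proof -
    have "k * 4 \<le> 4 ^ k" using k by (induction k rule: dec_induct) auto
    then show ?thesis using of_nat_mono[of "k * 4" "4 ^ k", where 'a = real] by simp
  qed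
  have half: "4 ^ k / (4 * real k) + 1 \<le> real (2 * k choose k)"
  proof -
    have "4 ^ k / (2 * real k) = 4 ^ k / (4 * real k) + 4 ^ k / (4 * real k)" by (simp add: field_simps)
    moreover have "1 \<le> 4 ^ k / (4 * real k)" using big k by (simp add: field_simps)
    ultimately show ?thesis using lower by linarith
  qed
  then have choose: "2 * k choose k = Suc q" using k unfolding q_def by simp
  ultimately have "card X = card {..q}" by simp
  then obtain layer where layer: "bij_betw layer {..q} X"
    using fin finite_same_card_bij by (metis finite_atMost)
  have mem: "layer d \<subseteq> {..<2 * k}" "card (layer d) = k" if "d \<le> q" for d
    using layer that by (auto simp: bij_betw_def X_def)
  have "4 * 2 \<le> 4 ^ k / (real k)"
  proof -
    have "k * 8 \<le> 4 ^ k" using k by (induction k rule: dec_induct) auto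
    then have "real k * 8 \<le> 4 ^ k" using of_nat_mono[of "k * 8" "4 ^ k", where 'a = real] by simp
    then show ?thesis using k by (simp add: field_simps)
  qed
  then have q2: "2 \<le> q" using half choose by (simp add: field_simps)
  have "antichain_code (2 * k) r q layer"
  proof
    fix d d' assume d: "d \<le> q" "d' \<le> q" and "layer d \<subseteq> layer d'"
    then have "layer d = layer d'" using mem by (metis card_subset_eq finite_lessThan finite_subset)
    then show "d = d'" using layer d by (auto simp: bij_betw_def inj_on_def)
  qed (use q2 r mem in auto)
  moreover have "4 ^ k / (4 * real k) \<le> real q" using half choose by simp
  ultimately show ?thesis using that by blast
qed

text \<open>
  Words of length \<open>2 * n ^ 4\<close> with \<open>2 * (n ^ 3 + 1)\<close> thresholds and \<open>n\<close> timers per group: the thresholds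
  reach \<open>n ^ 3\<close> beyond the mean, which is \<open>n\<close> times the order of the standard deviation, and yet their
  number, like that of the timers, is negligible compared with the length of the words. So the
  fraction of register cells in digit rows, the probabilities and the number of bits per cell all
  tend to 1.
\<close>
lemma parameters_exist:
  fixes p c \<beta> :: real
  assumes "0 < \<beta>" "\<beta> < 1" and "0 < p" "p < \<beta>" and "1 < c" "c < 2 powr \<beta>"
  obtains n :: nat where "2 \<le> n"
    and "0 < 1 - 16 * (1/2) ^ n - 2 * exp (- 2 * (real n ^ 3)\<^sup>2 / (2 * real n ^ 4 - 1))"
    and "p < 1 - 16 * (1/2) ^ n"
    and "p < \<beta> * (real (2 * n ^ 4) / real (2 * n ^ 4 + 2 * (n ^ 3 + 1) + 4 * n) *
        (1 - 16 * (1/2) ^ n - 2 * exp (- 2 * (real n ^ 3)\<^sup>2 / (2 * real n ^ 4 - 1))))"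
    and "log 2 c < \<beta> * ((2 * real n ^ 4 - log 2 (4 * real n ^ 4)) / real (2 * n ^ 4 + 2 * (n ^ 3 + 1) + 4 * n))"
proof -
  have logc: "log 2 c < \<beta>" using assms by (simp add: log_less_iff)
  have lim: "(\<lambda>n::nat. 1 - 16 * (1/2) ^ n - 2 * exp (- 2 * (real n ^ 3)\<^sup>2 / (2 * real n ^ 4 - 1))) \<longlonglongrightarrow> 1"
    by real_asymp
  have "(\<lambda>n::nat. real (2 * n ^ 4) / real (2 * n ^ 4 + 2 * (n ^ 3 + 1) + 4 * n)) \<longlonglongrightarrow> 1"
    by real_asymp
  note lim1 = tendsto_mult[OF tendsto_const[of \<beta>] tendsto_mult[OF this lim]]
  have "(\<lambda>n::nat. (2 * real n ^ 4 - log 2 (4 * real n ^ 4)) / real (2 * n ^ 4 + 2 * (n ^ 3 + 1) + 4 * n)) \<longlonglongrightarrow> 1"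
    by real_asymp
  note lim2 = tendsto_mult[OF tendsto_const[of \<beta>] this]
  have lim3: "(\<lambda>n::nat. 1 - 16 * (1/2) ^ n :: real) \<longlonglongrightarrow> 1" by real_asymp
  have "\<forall>\<^sub>F n in sequentially. 2 \<le> n \<and>
      0 < 1 - 16 * (1/2) ^ n - 2 * exp (- 2 * (real n ^ 3)\<^sup>2 / (2 * real n ^ 4 - 1)) \<and>
      p < 1 - 16 * (1/2) ^ n \<and>
      p < \<beta> * (real (2 * n ^ 4) / real (2 * n ^ 4 + 2 * (n ^ 3 + 1) + 4 * n) *
        (1 - 16 * (1/2) ^ n - 2 * exp (- 2 * (real n ^ 3)\<^sup>2 / (2 * real n ^ 4 - 1)))) \<and>
      log 2 c < \<beta> * ((2 * real n ^ 4 - log 2 (4 * real n ^ 4)) / real (2 * n ^ 4 + 2 * (n ^ 3 + 1) + 4 * n))"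
    using assms logc
    by (intro eventually_conj eventually_ge_at_top order_tendstoD(1)[OF lim]
        order_tendstoD(1)[OF lim1] order_tendstoD(1)[OF lim2] order_tendstoD(1)[OF lim3]) simp_all
  then obtain n where "2 \<le> n \<and>
      0 < 1 - 16 * (1/2) ^ n - 2 * exp (- 2 * (real n ^ 3)\<^sup>2 / (2 * real n ^ 4 - 1)) \<and>
      p < 1 - 16 * (1/2) ^ n \<and>
      p < \<beta> * (real (2 * n ^ 4) / real (2 * n ^ 4 + 2 * (n ^ 3 + 1) + 4 * n) *
        (1 - 16 * (1/2) ^ n - 2 * exp (- 2 * (real n ^ 3)\<^sup>2 / (2 * real n ^ 4 - 1)))) \<and>
      log 2 c < \<beta> * ((2 * real n ^ 4 - log 2 (4 * real n ^ 4)) / real (2 * n ^ 4 + 2 * (n ^ 3 + 1) + 4 * n))"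
    using eventually_happens'[OF sequentially_bot] by blast
  then show ?thesis using that by (elim conjE)
qed

text \<open>
  The gap left by \<open>\<epsilon>\<close> will absorb the terms of order \<open>o(N)\<close>: the circuit, the depth of the tree and
  the losses by rounding.
\<close>
lemma slack:
  fixes x y z w \<beta> :: real
  assumes "x < \<beta> * y" "z < \<beta> * w"
  obtains \<epsilon> where "0 < \<epsilon>" "x < (\<beta> - \<epsilon>) * y" "z < (\<beta> - \<epsilon>) * w"
proof -
  have "((\<lambda>\<epsilon>. (\<beta> - \<epsilon>) * y) \<longlongrightarrow> (\<beta> - 0) * y) (at_right 0)"
    "((\<lambda>\<epsilon>. (\<beta> - \<epsilon>) * w) \<longlongrightarrow> (\<beta> - 0) * w) (at_right 0)"
    by (intro tendsto_intros)+
  then have "\<forall>\<^sub>F \<epsilon> in at_right 0. 0 < \<epsilon> \<and> x < (\<beta> - \<epsilon>) * y \<and> z < (\<beta> - \<epsilon>) * w"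
    using assms by (intro eventually_conj eventually_at_right_less order_tendstoD(1)) auto
  then show ?thesis using that eventually_happens'[OF trivial_limit_at_right_real] by blast
qed

theorem theorem3p8:
  fixes \<alpha> p c :: real
  assumes "0 < \<alpha>" and "\<alpha> < 1/2"
    and "0 < p" and "p < 1 - 2 * \<alpha>"
    and "1 < c" and "c < 2 powr (1 - 2 * \<alpha>)"
  shows "\<exists>N0. \<forall>N\<ge>N0. \<exists>f.
           boolean_network N f \<and> cooperative N f \<and> bi_quadratic N f \<and>
           chaotic p c N f \<and> decoherent p \<alpha> N f"
proof -
  define \<beta> where "\<beta> = 1 - 2 * \<alpha>"
  have \<beta>: "0 < \<beta>" "\<beta> < 1" "p < \<beta>" "c < 2 powr \<beta>" using assms by (auto simp: \<beta>_def)
  obtain n :: nat where n: "2 \<le> n"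
    and \<delta>0: "0 < 1 - 16 * (1/2) ^ n - 2 * exp (- 2 * (real n ^ 3)\<^sup>2 / (2 * real n ^ 4 - 1))"
    and p: "p < 1 - 16 * (1/2) ^ n"
    and p\<delta>0: "p < \<beta> * (real (2 * n ^ 4) / real (2 * n ^ 4 + 2 * (n ^ 3 + 1) + 4 * n) *
        (1 - 16 * (1/2) ^ n - 2 * exp (- 2 * (real n ^ 3)\<^sup>2 / (2 * real n ^ 4 - 1))))"
    and c0: "log 2 c < \<beta> * ((2 * real n ^ 4 - log 2 (4 * real n ^ 4)) / real (2 * n ^ 4 + 2 * (n ^ 3 + 1) + 4 * n))"
    using parameters_exist[OF \<beta>(1,2) assms(3) \<beta>(3) assms(5) \<beta>(4)] by blast
  define k where "k = n ^ 4"
  define l where "l = 2 * k"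
  define r where "r = 2 * (n ^ 3 + 1)"
  define lo where "lo = k - (n ^ 3 + 1)"
  define A where "A = l + r + 4 * n"
  define \<delta> where "\<delta> = 1 - 16 * (1/2) ^ n - 2 * exp (- 2 * (real (n ^ 3))\<^sup>2 / real (l - 1))"
  define q where "q = (2 * k choose k) - 1"
  have k: "n ^ 3 + 1 \<le> k" "2 \<le> k"
  proof -
    have "2 ^ 3 \<le> n ^ 3" using n by (rule power_mono) simp
    then have "8 \<le> n ^ 3" by simp
    moreover have "2 * n ^ 3 \<le> n * n ^ 3" using n by (rule mult_le_mono1)
    moreover have "n * n ^ 3 = k" by (simp add: k_def numeral_eq_Suc)
    ultimately show "n ^ 3 + 1 \<le> k" "2 \<le> k" by linarith+
  qed
  have "real (l - 1) = 2 * real n ^ 4 - 1" using k by (simp add: l_def k_def of_nat_diff)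
  then have \<delta>: "0 < \<delta>" "p < \<beta> * (real l / real A * \<delta>)"
    using \<delta>0 p\<delta>0 by (simp_all add: \<delta>_def A_def l_def k_def r_def)
  have r: "0 < r" by (simp add: r_def)
  obtain layer where layer: "antichain_code (2 * k) r q layer" and q_ge: "4 ^ k / (4 * real k) \<le> real q"
    unfolding q_def using middle_layer_code[OF k(2) r] by blast
  interpret C: antichain_code l r n q lo layer unfolding l_def by (rule layer)
  obtain \<phi> H where \<phi>: "\<forall>a\<in>set C.rows. formula_vars (\<phi> a) \<subseteq> set C.rows \<and>
      formula_depth (\<phi> a) \<le> H \<and> (\<forall>x. formula_val (\<phi> a) x = C.logic a x)"
    using C.formulas_exist by blast
  define D where "D = 2 * H + length C.rows + 3"
  have A_pos: "0 < A" using n by (simp add: A_def)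
  have q_pos: "1 < real q" using C.q by simp
  have "2 * real n ^ 4 - log 2 (4 * real n ^ 4) = log 2 (4 ^ k / (4 * real k))"
  proof -
    have "log 2 (4 ^ k / (4 * real k)) = log 2 (4 ^ k) - log 2 (4 * real k)"
      using k by (subst log_divide_pos) auto
    also have "log 2 ((4::real) ^ k) = 2 * real k"
      using log_pow_cancel[of 2 "2 * k"] by (simp add: power_mult)
    finally show ?thesis by (simp add: k_def)
  qed
  also have "\<dots> \<le> log 2 (real q)" using q_ge q_pos k by (intro log_mono) auto
  finally have "log 2 c < \<beta> * (log 2 (real q) / real A)"
    using c0 \<beta>(1) A_pos
    by (elim order_less_le_trans) (auto simp: A_def l_def k_def r_def intro!: mult_left_mono divide_right_mono)
  then obtain \<epsilon> where \<epsilon>: "0 < \<epsilon>" "p < (\<beta> - \<epsilon>) * (real l / real A * \<delta>)"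
      "log 2 c < (\<beta> - \<epsilon>) * (log 2 (real q) / real A)"
    using slack[OF \<delta>(2)] by blast
  \<comment> \<open>The circuit, and what is lost by rounding \<open>M\<close> and by passing from \<open>M\<close> to \<open>M - (D + 2)\<close>.\<close>
  define K where "K = 2 * D * 2 ^ D + A + A * D + A * (D + 2)"
  have "(\<lambda>N::nat. (log 2 (real N + 1) + 1) / real N + real K * (1 / real N)) \<longlonglongrightarrow> 0 + real K * 0"
    by (intro tendsto_add tendsto_mult tendsto_const) real_asymp+
  then have "\<forall>\<^sub>F N in sequentially. (log 2 (real N + 1) + 1) / real N + real K * (1 / real N) < \<epsilon>"
    using \<epsilon>(1) by (intro order_tendstoD(2)) auto
  then obtain N0 where N0: "\<And>N. N0 \<le> N \<Longrightarrow> (log 2 (real N + 1) + 1) / real N + real K * (1 / real N) < \<epsilon>"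
    by (auto simp: eventually_sequentially)
  show ?thesis
  proof (intro exI[of _ "Suc N0"] allI impI)
    fix N assume N: "Suc N0 \<le> N"
    then have N_pos: "0 < N" by simp
    define L where "L = nat \<lfloor>\<alpha> * real N\<rfloor>"
    define d where "d = nat \<lceil>log 2 (real N + 1)\<rceil>"
    have L_bounds: "real L \<le> \<alpha> * real N" "\<alpha> * real N \<le> real L + 1"
      using assms(1) by (simp_all add: L_def)
    have d: "real d \<le> log 2 (real N + 1) + 1" unfolding d_def by (simp add: ceiling_le_iff)
    have "L < 2 ^ d"
    proof -
      have "real L \<le> 1 * real N" using L_bounds(1) assms(2) N_pos by (elim order_trans) (intro mult_right_mono, auto)
      also have "\<dots> < 2 powr (log 2 (real N + 1))" by simp
      also have "\<dots> \<le> 2 powr real d" unfolding d_def by (intro powr_mono) linarith+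
      also have "\<dots> = real (2 ^ d)" by (simp add: powr_realpow)
      finally show ?thesis by (simp only: of_nat_less_iff)
    qed
    have budget: "(\<beta> - \<epsilon>) * real N \<le> real N - 2 * real L - real d - real K"
    proof -
      have "(log 2 (real N + 1) + 1 + real K) / real N < \<epsilon>"
        using N0[of N] N by (simp add: add_divide_distrib)
      then have "log 2 (real N + 1) + 1 + real K < \<epsilon> * real N" using N_pos by (simp add: field_simps)
      then show ?thesis using d L_bounds(1) by (simp add: \<beta>_def algebra_simps)
    qed
    have "0 < \<beta> - \<epsilon>"
    proof (rule ccontr)
      assume "\<not> 0 < \<beta> - \<epsilon>"
      then have "(\<beta> - \<epsilon>) * (real l / real A * \<delta>) \<le> 0"
        using \<delta>(1) by (intro mult_nonpos_nonneg) auto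
      then show False using \<epsilon>(2) assms(3) by linarith
    qed
    then have "0 < (\<beta> - \<epsilon>) * real N" using N_pos by simp
    with budget have "2 * real L + real d + real K < real N" by linarith
    then have room: "2 * L + d + K < N" by linarith
    define R where "R = N - 2 * L - d - 2 * D * 2 ^ D - A"
    \<comment> \<open>The largest round length \<open>M = m * D + 1\<close> that the budget of nodes allows.\<close>
    define m where "m = R div (A * D)"
    define M where "M = m * D + 1"
    have D_pos: "0 < D" by (simp add: D_def)
    have "A * D \<le> R" using room by (simp add: R_def K_def)
    then have m: "0 < m" using A_pos D_pos by (simp add: m_def div_greater_zero_iff)
    have "A * D * m \<le> R" unfolding m_def by simp
    have A_M: "A * M = A * D * m + A" by (simp add: M_def algebra_simps)
    then have size: "(l + r + 4 * n) * M + 2 * L + d + 2 * D * 2 ^ D \<le> N"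
      using \<open>A * D * m \<le> R\<close> room unfolding A_def[symmetric] R_def K_def by linarith
    have "R < A * D * m + A * D" unfolding m_def
      using A_pos D_pos by (metis add.commute dividend_less_div_times mult.commute mult_pos_pos)
    then have AM: "N < A * M + 2 * L + d + 2 * D * 2 ^ D + A * D"
      using room A_M unfolding R_def K_def by linarith
    have M_large: "(\<beta> - \<epsilon>) * real N / real A \<le> real (M - (D + 2))"
    proof -
      have "A * M \<le> A * (M - (D + 2)) + A * (D + 2)"
        by (simp add: diff_mult_distrib2)
      then have "N < A * (M - (D + 2)) + 2 * L + d + K" using AM unfolding K_def by linarith
      then have "real N < real (A * (M - (D + 2)) + 2 * L + d + K)" by (simp only: of_nat_less_iff)
      then have "(\<beta> - \<epsilon>) * real N \<le> real A * real (M - (D + 2))" using budget by simp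
      then show ?thesis using A_pos by (simp add: field_simps)
    qed
    interpret counter_network l r n q lo layer \<phi> H m M D L d N
      using \<phi> m \<open>L < 2 ^ d\<close> by unfold_locales (auto simp: M_def D_def)
    have "c ^ N < real (q ^ (M - 2))"
    proof -
      have "c ^ N = 2 powr (log 2 c * real N)"
        using assms(5) by (simp add: powr_powr[symmetric] powr_realpow)
      also have "\<dots> < 2 powr ((\<beta> - \<epsilon>) * (log 2 (real q) / real A) * real N)"
        using N_pos by (intro powr_less_mono mult_strict_right_mono \<epsilon>(3)) simp_all
      also have "\<dots> = real q powr ((\<beta> - \<epsilon>) * real N / real A)"
      proof -
        have "real q powr y = 2 powr (log 2 (real q) * y)" for y
          using q_pos by (simp add: powr_powr[symmetric])
        then show ?thesis by (simp add: mult_ac)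
      qed
      also have "\<dots> \<le> real q powr real (M - 2)"
      proof (intro powr_mono)
        have "real (M - (D + 2)) \<le> real (M - 2)" by simp
        then show "(\<beta> - \<epsilon>) * real N / real A \<le> real (M - 2)" using M_large by linarith
      qed (use q_pos in simp)
      also have "\<dots> = real (q ^ (M - 2))" using q_pos by (simp add: powr_realpow)
      finally show ?thesis .
    qed
    moreover have "p \<le> real l * real (M - D) / real N * \<delta>"
    proof -
      have "real (M - (D + 2)) \<le> real (M - D)" by simp
      then have "(\<beta> - \<epsilon>) * real N / real A \<le> real (M - D)" using M_large by linarith
      then have "real l / real N * \<delta> * ((\<beta> - \<epsilon>) * real N / real A) \<le> real l / real N * \<delta> * real (M - D)"
        using \<delta>(1) by (intro mult_left_mono) auto
      moreover have "real l / real N * \<delta> * ((\<beta> - \<epsilon>) * real N / real A) = (\<beta> - \<epsilon>) * (real l / real A * \<delta>)"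
        using N_pos by simp
      moreover have "real l / real N * \<delta> * real (M - D) = real l * real (M - D) / real N * \<delta>" by simp
      ultimately have "(\<beta> - \<epsilon>) * (real l / real A * \<delta>) \<le> real l * real (M - D) / real N * \<delta>"
        by linarith
      then show ?thesis using \<epsilon>(2) by linarith
    qed
    ultimately show "\<exists>f. boolean_network N f \<and> cooperative N f \<and> bi_quadratic N f \<and>
           chaotic p c N f \<and> decoherent p \<alpha> N f"
      using n k p \<delta>(1) L_bounds(2) N_pos
      by (intro chaotic_decoherent_network[OF size N_pos, of p c \<alpha> "real (n ^ 3)"])
        (auto simp: \<delta>_def l_def lo_def r_def of_nat_diff)
  qed
qed

end
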